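(* Let $\mathbb{K}$ be a field of arbitrary characteristic. For every complete (possibly curved) shifted $A_\infty$-algebra $(A,Q)$ over $\mathbb{K}$, the Maurer-Cartan simplicial set $MC_\bullet(A,Q)$ is a Kan complex.
   Context: Gradings are cohomological; the Koszul sign rule is used throughout; tensor products are over $\mathbb{K}$; $A^{\otimes 0}=\mathbb{K}$. A (curved) shifted $A_\infty$-algebra $(A,Q)$ is a $\mathbb{Z}$-graded vector space $A$ with linear maps $Q_n\colon A^{\otimes n}\to A$ of degree $+1$, $n\ge 0$, such that $\sum_{a+b+c=n}Q_{a+c+1}\circ(\mathrm{id}^{\otimes a}\otimes Q_b\otimes \mathrm{id}^{\otimes c})=0$ for all $n\ge 0$. It is complete if it is equipped with a decreasing filtration by graded subspaces $A=F^1A\supset F^2A\supset\cdots$ with $\bigcap_kF^kA=\{0\}$ and $Q_n(F^{i_1}A\otimes\cdots\otimes F^{i_n}A)\subset F^{i_1+\cdots+i_n}A$, and every Cauchy sequence for the filtration topology (the metric $d(v,w)=2^{-\max\{k\mid v-w\in F^kA\}}$ for $v\ne w$) converges. Maurer-Cartan elements: $MC(A,Q)$ is the set of $x\in A^0$ with $\sum_{l\ge 0}Q_l(x^{\otimes l})=0$ (the sum converges by completeness). Normalized cochains: $N^\bullet(\Delta^n)$ is the unital dg associative algebra of normalized simplicial cochains on $\Delta^n$ with coefficients in $\mathbb{K}$. A basis of its degree $d$ part is $\varphi_{i_0,\dots,i_d}$, $0\le i_0<\dots<i_d\le n$, the cochain which is $1$ on the face with vertices $i_0,\dots,i_d$ and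 $0$ on all other nondegenerate simplices. The differential is the usual $(d\varphi)(j_0,\dots,j_{d+1})=\sum_k(-1)^k\varphi(j_0,\dots,\widehat{j_k},\dots,j_{d+1})$. The product is the cup product $\varphi_{i_0,\dots,i_d}\cup\varphi_{j_0,\dots,j_e}=\varphi_{i_0,\dots,i_d,j_1,\dots,j_e}$ if $i_d=j_0$ and $0$ otherwise; the unit is $\mathbbm{1}=\sum_{i=0}^n\varphi_i$. The $N^\bullet(\Delta^n)$, $n\ge0$, form a simplicial dg algebra, with face and degeneracy maps given by pullback along the standard coface and codegeneracy maps of $\Delta^\bullet$. Extension of scalars: $A\otimes N^\bullet(\Delta^n)$ is a shifted $A_\infty$-algebra with structure maps $NQ_0(1)=Q_0(1)\otimes\mathbbm{1}$, $NQ_1=Q_1\otimes\mathrm{id}+\mathrm{id}\otimes d$, and $NQ_k=Q_k\otimes\cup^{(k)}$ for $k\ge2$, using $(A\otimes N^\bullet)^{\otimes k}\cong A^{\otimes k}\otimes (N^\bullet)^{\otimes k}$ (with Koszul signs), where $\cup^{(k)}$ is the $(k-1)$-fold iterated cup product of $k$ factors. It is filtered by $F^i(A\otimes N^\bullet(\Delta^n))=F^iA\otimes N^\bullet(\Delta^n)$ and is complete. The Maurer-Cartan simplicial set $MC_\bullet(A,Q)$ has $n$-simplices $MC_n(A,Q)=MC(A\otimes N^\bullet(\Delta^n),NQ)$, with face and degeneracy maps induced by those of $A\otimes N^\bullet(\Delta^\bullet)$. *)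

theory Defs
  imports "HOL-Analysis.Abstract_Metric_Spaces" "HOL-Library.Function_Algebras"
begin

section \<open>Graded vector spaces\<close>

locale graded_vector_space = vector_space smul
  for smul :: "'k::field \<Rightarrow> 'a::ab_group_add \<Rightarrow> 'a" +
  fixes gr :: "int \<Rightarrow> 'a set"
  assumes gr_subspace: "subspace (gr d)"
    and gr_decomposition:
      "\<exists>!f. (\<forall>d. f d \<in> gr d) \<and> finite {d. f d \<noteq> 0} \<and> x = (\<Sum>d | f d \<noteq> 0. f d)"

definition hcomp :: "(int \<Rightarrow> 'a::ab_group_add set) \<Rightarrow> 'a \<Rightarrow> int \<Rightarrow> 'a" where
  "hcomp gr x = (THE f. (\<forall>d. f d \<in> gr d) \<and> finite {d. f d \<noteq> 0} \<and> x = (\<Sum>d | f d \<noteq> 0. f d))"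

text \<open>The linear involution \<open>x \<mapsto> (-1)\<^sup>|\<^sup>x\<^sup>| x\<close>. All Koszul signs below are written with it: moving
  \<open>x\<close> past something of degree \<open>p\<close> replaces \<open>x\<close> by \<open>(koszul gr ^^ p) x\<close>, also for
  inhomogeneous \<open>x\<close>.\<close>

definition koszul :: "(int \<Rightarrow> 'a::ab_group_add set) \<Rightarrow> 'a \<Rightarrow> 'a" where
  "koszul gr x = (\<Sum>d | hcomp gr x d \<noteq> 0. if even d then hcomp gr x d else - hcomp gr x d)"

section \<open>Shifted A-infinity algebras\<close>

text \<open>A linear map on the \<open>n\<close>-th tensor power is given as an \<open>n\<close>-linear map, and \<open>Q\<^sub>n\<close> is \<open>Q\<close>
  restricted to lists of length \<open>n\<close>; in particular \<open>Q []\<close> is the curvature \<open>Q\<^sub>0(1)\<close>.\<close>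

locale shifted_Ainf = graded_vector_space smul gr
  for smul :: "'k::field \<Rightarrow> 'a::ab_group_add \<Rightarrow> 'a" and gr :: "int \<Rightarrow> 'a set" +
  fixes Q :: "'a list \<Rightarrow> 'a"
  assumes Q_multilinear: "Vector_Spaces.linear smul smul (\<lambda>x. Q (xs @ x # ys))"
    and Q_degree: "list_all2 (\<lambda>x d. x \<in> gr d) xs ds \<Longrightarrow> Q xs \<in> gr (sum_list ds + 1)"
    and Q_relations:
      "(\<Sum>(a, b) | a + b \<le> length xs.
          Q (map (koszul gr) (take a xs) @ Q (take b (drop a xs)) # drop (a + b) xs)) = 0"

text \<open>Filtrations are indexed by \<open>k \<ge> 1\<close>; the value \<open>F 0\<close> is never used.\<close>

definition filt_dist :: "(nat \<Rightarrow> 'a::ab_group_add set) \<Rightarrow> 'a \<Rightarrow> 'a \<Rightarrow> real" where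
  "filt_dist F v w = (if v = w then 0 else 1 / 2 ^ Max {k. 1 \<le> k \<and> v - w \<in> F k})"

text \<open>Completeness is required in every degree, a graded vector space being the family of its
  homogeneous parts. For the direct sum of these parts this is weaker than convergence of all
  Cauchy sequences (see \<open>mcomplete_gr_if_mcomplete_UNIV\<close>), which would exclude, for instance,
  \<open>F\<close> with infinitely many nonzero degrees in every \<open>F k\<close>.\<close>

locale complete_shifted_Ainf = shifted_Ainf smul gr Q
  for smul :: "'k::field \<Rightarrow> 'a::ab_group_add \<Rightarrow> 'a" and gr :: "int \<Rightarrow> 'a set"
    and Q :: "'a list \<Rightarrow> 'a" +
  fixes F :: "nat \<Rightarrow> 'a set"
  assumes F_one: "F 1 = UNIV"
    and F_decreasing: "1 \<le> k \<Longrightarrow> F (Suc k) \<subseteq> F k"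
    and F_subspace: "1 \<le> k \<Longrightarrow> subspace (F k)"
    and F_graded: "1 \<le> k \<Longrightarrow> x \<in> F k \<Longrightarrow> hcomp gr x d \<in> F k"
    and F_separated: "(\<Inter>k\<in>{1..}. F k) = {0}"
    and F_Q: "xs \<noteq> [] \<Longrightarrow> list_all2 (\<lambda>x i. 1 \<le> i \<and> x \<in> F i) xs ks \<Longrightarrow> Q xs \<in> F (sum_list ks)"
    and F_complete: "Metric_space.mcomplete (gr d) (filt_dist F)"

text \<open>For \<open>x\<close> of degree \<open>0\<close> all \<open>Q\<^sub>l(x, \<dots>, x)\<close> have degree \<open>1\<close>, so the series is taken in \<open>gr 1\<close>.\<close>

definition MC :: "(int \<Rightarrow> 'a::ab_group_add set) \<Rightarrow> (nat \<Rightarrow> 'a set) \<Rightarrow> ('a list \<Rightarrow> 'a) \<Rightarrow> 'a set" where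
  "MC gr F Q = {x \<in> gr 0.
     limitin (Metric_space.mtopology (gr 1) (filt_dist F))
       (\<lambda>m. \<Sum>l<m. Q (replicate l x)) 0 sequentially}"

section \<open>Normalized cochains on the standard simplex\<close>

text \<open>A nondegenerate simplex is the list of its vertices; a cochain is a function on all lists
  that vanishes outside \<open>faces n\<close>.\<close>

definition faces :: "nat \<Rightarrow> nat list set" where
  "faces n = {\<sigma>. \<sigma> \<noteq> [] \<and> sorted_wrt (<) \<sigma> \<and> set \<sigma> \<subseteq> {..n}}"

definition sdim :: "nat list \<Rightarrow> nat" where
  "sdim \<sigma> = length \<sigma> - 1"

type_synonym 'k cochain = "nat list \<Rightarrow> 'k"

definition basis_cochain :: "nat list \<Rightarrow> 'k::field cochain" where
  "basis_cochain \<sigma> = (\<lambda>\<tau>. if \<tau> = \<sigma> then 1 else 0)"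

text \<open>For a vertex \<open>\<tau>\<close> the only summand is \<open>\<phi> []\<close>, which is \<open>0\<close>.\<close>

definition cochain_d :: "nat \<Rightarrow> 'k::field cochain \<Rightarrow> 'k cochain" where
  "cochain_d n \<phi> = (\<lambda>\<tau>. if \<tau> \<in> faces n
     then \<Sum>k<length \<tau>. (- 1) ^ k * \<phi> (take k \<tau> @ drop (Suc k) \<tau>) else 0)"

definition cup_basis :: "nat list \<Rightarrow> nat list \<Rightarrow> 'k::field cochain" where
  "cup_basis \<sigma> \<rho> = (if last \<sigma> = hd \<rho> then basis_cochain (\<sigma> @ tl \<rho>) else 0)"

definition cup :: "nat \<Rightarrow> 'k::field cochain \<Rightarrow> 'k cochain \<Rightarrow> 'k cochain" where
  "cup n \<phi> \<psi> = (\<lambda>\<tau>. \<Sum>\<sigma>\<in>faces n. \<Sum>\<rho>\<in>faces n. \<phi> \<sigma> * \<psi> \<rho> * cup_basis \<sigma> \<rho> \<tau>)"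

definition cochain_one :: "nat \<Rightarrow> 'k::field cochain" where
  "cochain_one n = (\<Sum>i\<le>n. basis_cochain [i])"

fun cup_list :: "nat \<Rightarrow> 'k::field cochain list \<Rightarrow> 'k cochain" where
  "cup_list n [] = cochain_one n"
| "cup_list n [\<phi>] = \<phi>"
| "cup_list n (\<phi> # \<psi> # \<phi>s) = cup n \<phi> (cup_list n (\<psi> # \<phi>s))"

definition coface :: "nat \<Rightarrow> nat \<Rightarrow> nat" where
  "coface i j = (if j < i then j else Suc j)"

definition codegeneracy :: "nat \<Rightarrow> nat \<Rightarrow> nat" where
  "codegeneracy i j = (if j \<le> i then j else j - 1)"

text \<open>Pullback to the \<open>m\<close>-simplex along the map given by \<open>\<theta>\<close> on vertices. If the image \<open>map \<theta> \<tau>\<close>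
  is degenerate, it is not a face and \<open>\<phi>\<close> vanishes on it.\<close>

definition pullback :: "nat \<Rightarrow> (nat \<Rightarrow> nat) \<Rightarrow> 'k::field cochain \<Rightarrow> 'k cochain" where
  "pullback m \<theta> \<phi> = (\<lambda>\<tau>. if \<tau> \<in> faces m then \<phi> (map \<theta> \<tau>) else 0)"

section \<open>Extension of scalars\<close>

text \<open>Since the cochains have the finite basis \<open>faces n\<close>, their tensor product with \<open>A\<close> is
  modelled by the \<open>A\<close>-valued functions on lists that vanish outside \<open>faces n\<close>: the function \<open>x\<close>
  stands for the sum of the \<open>x \<sigma> \<otimes> \<phi>\<^sub>\<sigma>\<close> (see \<open>tensor_expansion\<close>).\<close>

definition tensor ::
    "('k::field \<Rightarrow> 'a::ab_group_add \<Rightarrow> 'a) \<Rightarrow> 'a \<Rightarrow> 'k cochain \<Rightarrow> (nat list \<Rightarrow> 'a)" where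
  "tensor smul a \<phi> = (\<lambda>\<tau>. smul (\<phi> \<tau>) a)"

definition tensor_space :: "nat \<Rightarrow> (nat list \<Rightarrow> 'a::ab_group_add) set" where
  "tensor_space n = {x. \<forall>\<sigma>. \<sigma> \<notin> faces n \<longrightarrow> x \<sigma> = 0}"

definition tensor_gr ::
    "(int \<Rightarrow> 'a::ab_group_add set) \<Rightarrow> nat \<Rightarrow> int \<Rightarrow> (nat list \<Rightarrow> 'a) set" where
  "tensor_gr gr n d = {x \<in> tensor_space n. \<forall>\<sigma>\<in>faces n. x \<sigma> \<in> gr (d - int (sdim \<sigma>))}"

definition tensor_F ::
    "(nat \<Rightarrow> 'a::ab_group_add set) \<Rightarrow> nat \<Rightarrow> nat \<Rightarrow> (nat list \<Rightarrow> 'a) set" where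
  "tensor_F F n k = {x \<in> tensor_space n. \<forall>\<sigma>\<in>faces n. x \<sigma> \<in> F k}"

text \<open>\<open>g \<otimes> f\<close> without any sign, for linear \<open>g\<close> and \<open>f\<close>.\<close>

definition tensor_map ::
    "('k::field \<Rightarrow> 'a::ab_group_add \<Rightarrow> 'a) \<Rightarrow> nat \<Rightarrow> ('a \<Rightarrow> 'a) \<Rightarrow> ('k cochain \<Rightarrow> 'k cochain) \<Rightarrow>
     (nat list \<Rightarrow> 'a) \<Rightarrow> (nat list \<Rightarrow> 'a)" where
  "tensor_map smul n g f x = (\<Sum>\<sigma>\<in>faces n. tensor smul (g (x \<sigma>)) (f (basis_cochain \<sigma>)))"

text \<open>In \<open>id \<otimes> d\<close> the sign is \<open>(-1)\<^sup>|\<^sup>a\<^sup>|\<close>. For \<open>k \<ge> 2\<close>, rearranging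
  \<open>(a\<^sub>0 \<otimes> \<phi>\<^sub>0) \<otimes> \<dots> \<otimes> (a\<^sub>k\<^sub>-\<^sub>1 \<otimes> \<phi>\<^sub>k\<^sub>-\<^sub>1)\<close> moves \<open>a\<^sub>j\<close> past all \<open>\<phi>\<^sub>i\<close> with \<open>i < j\<close>.\<close>

fun NQ :: "('k::field \<Rightarrow> 'a::ab_group_add \<Rightarrow> 'a) \<Rightarrow> (int \<Rightarrow> 'a set) \<Rightarrow> ('a list \<Rightarrow> 'a) \<Rightarrow> nat \<Rightarrow>
    (nat list \<Rightarrow> 'a) list \<Rightarrow> (nat list \<Rightarrow> 'a)" where
  "NQ smul gr Q n [] = tensor smul (Q []) (cochain_one n)"
| "NQ smul gr Q n [x] =
     tensor_map smul n (\<lambda>a. Q [a]) id x + tensor_map smul n (koszul gr) (cochain_d n) x"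
| "NQ smul gr Q n (x # y # zs) =
     (let xs = x # y # zs; k = length xs in
      \<Sum>\<sigma>s | length \<sigma>s = k \<and> set \<sigma>s \<subseteq> faces n.
        tensor smul
          (Q (map (\<lambda>j. (koszul gr ^^ (\<Sum>i<j. sdim (\<sigma>s ! i))) ((xs ! j) (\<sigma>s ! j))) [0..<k]))
          (cup_list n (map basis_cochain \<sigma>s)))"

section \<open>The Maurer-Cartan simplicial set\<close>

definition MC_simp :: "('k::field \<Rightarrow> 'a::ab_group_add \<Rightarrow> 'a) \<Rightarrow> (int \<Rightarrow> 'a set) \<Rightarrow> ('a list \<Rightarrow> 'a) \<Rightarrow>
    (nat \<Rightarrow> 'a set) \<Rightarrow> nat \<Rightarrow> (nat list \<Rightarrow> 'a) set" where
  "MC_simp smul gr Q F n = MC (tensor_gr gr n) (tensor_F F n) (NQ smul gr Q n)"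

definition MC_face :: "('k::field \<Rightarrow> 'a::ab_group_add \<Rightarrow> 'a) \<Rightarrow> nat \<Rightarrow> nat \<Rightarrow>
    (nat list \<Rightarrow> 'a) \<Rightarrow> (nat list \<Rightarrow> 'a)" where
  "MC_face smul n i = tensor_map smul (Suc n) id (pullback n (coface i))"

definition MC_degen :: "('k::field \<Rightarrow> 'a::ab_group_add \<Rightarrow> 'a) \<Rightarrow> nat \<Rightarrow> nat \<Rightarrow>
    (nat list \<Rightarrow> 'a) \<Rightarrow> (nat list \<Rightarrow> 'a)" where
  "MC_degen smul n i = tensor_map smul n id (pullback (Suc n) (codegeneracy i))"

section \<open>Simplicial sets and Kan complexes\<close>

text \<open>\<open>face n i\<close> goes from \<open>X (Suc n)\<close> to \<open>X n\<close>, and \<open>degen n i\<close> from \<open>X n\<close> to \<open>X (Suc n)\<close>.\<close>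

locale simplicial_set =
  fixes X :: "nat \<Rightarrow> 'x set" and face degen :: "nat \<Rightarrow> nat \<Rightarrow> 'x \<Rightarrow> 'x"
  assumes face_in: "x \<in> X (Suc n) \<Longrightarrow> i \<le> Suc n \<Longrightarrow> face n i x \<in> X n"
    and degen_in: "x \<in> X n \<Longrightarrow> i \<le> n \<Longrightarrow> degen n i x \<in> X (Suc n)"
    and face_face: "x \<in> X (Suc (Suc n)) \<Longrightarrow> i < j \<Longrightarrow> j \<le> Suc (Suc n) \<Longrightarrow>
      face n i (face (Suc n) j x) = face n (j - 1) (face (Suc n) i x)"
    and face_degen_less: "x \<in> X (Suc n) \<Longrightarrow> i < j \<Longrightarrow> j \<le> Suc n \<Longrightarrow>
      face (Suc n) i (degen (Suc n) j x) = degen n (j - 1) (face n i x)"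
    and face_degen_id: "x \<in> X n \<Longrightarrow> j \<le> n \<Longrightarrow> i = j \<or> i = Suc j \<Longrightarrow>
      face n i (degen n j x) = x"
    and face_degen_greater: "x \<in> X (Suc n) \<Longrightarrow> Suc j < i \<Longrightarrow> i \<le> Suc (Suc n) \<Longrightarrow>
      face (Suc n) i (degen (Suc n) j x) = degen n j (face n (i - 1) x)"
    and degen_degen: "x \<in> X n \<Longrightarrow> i \<le> j \<Longrightarrow> j \<le> n \<Longrightarrow>
      degen (Suc n) i (degen n j x) = degen (Suc n) (Suc j) (degen n i x)"

text \<open>A horn of dimension \<open>Suc n\<close> without the \<open>k\<close>-th face is a compatible family \<open>y\<close> of
  \<open>n\<close>-simplices. For \<open>n = 0\<close> the compatibility is void, as no \<open>i < j \<le> 1\<close> both differ from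
  \<open>k\<close>.\<close>

locale kan_complex = simplicial_set X face degen
  for X :: "nat \<Rightarrow> 'x set" and face degen :: "nat \<Rightarrow> nat \<Rightarrow> 'x \<Rightarrow> 'x" +
  assumes horn_filler:
    "k \<le> Suc n \<Longrightarrow>
     (\<And>i. i \<le> Suc n \<Longrightarrow> i \<noteq> k \<Longrightarrow> y i \<in> X n) \<Longrightarrow>
     (\<And>i j. i < j \<Longrightarrow> j \<le> Suc n \<Longrightarrow> i \<noteq> k \<Longrightarrow> j \<noteq> k \<Longrightarrow>
        face (n - 1) i (y j) = face (n - 1) (j - 1) (y i)) \<Longrightarrow>
     \<exists>x\<in>X (Suc n). \<forall>i\<le>Suc n. i \<noteq> k \<longrightarrow> face n i x = y i"

section \<open>Consistency of the encodings\<close>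

lemma finite_faces: "finite (faces n)"
proof (rule finite_subset)
  show "faces n \<subseteq> {xs. set xs \<subseteq> {..n} \<and> distinct xs}"
    by (auto simp: faces_def strict_sorted_iff)
  show "finite {xs. set xs \<subseteq> {..n} \<and> distinct xs}"
    by (rule finite_subset_distinct) simp
qed

lemma (in vector_space) tensor_expansion:
  assumes "x \<in> tensor_space n"
  shows "(\<Sum>\<sigma>\<in>faces n. tensor scale (x \<sigma>) (basis_cochain \<sigma>)) = x"
proof
  fix \<tau>
  have *: "(\<Sum>\<sigma>\<in>S. f \<sigma>) \<tau> = (\<Sum>\<sigma>\<in>S. f \<sigma> \<tau>)" if "finite S"
    for S :: "nat list set" and f :: "nat list \<Rightarrow> nat list \<Rightarrow> 'b"
    using that by (induction S rule: finite_induct) auto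
  have "(\<Sum>\<sigma>\<in>faces n. tensor scale (x \<sigma>) (basis_cochain \<sigma>)) \<tau>
      = (\<Sum>\<sigma>\<in>faces n. if \<tau> = \<sigma> then x \<sigma> else 0)"
    unfolding *[OF finite_faces] by (rule sum.cong) (auto simp: tensor_def basis_cochain_def)
  also have "\<dots> = x \<tau>"
    using assms by (auto simp: finite_faces tensor_space_def)
  finally show "(\<Sum>\<sigma>\<in>faces n. tensor scale (x \<sigma>) (basis_cochain \<sigma>)) \<tau> = x \<tau>" .
qed

lemma (in graded_vector_space) hcomp_props:
  "(\<forall>d. hcomp gr x d \<in> gr d) \<and> finite {d. hcomp gr x d \<noteq> 0} \<and>
    x = (\<Sum>d | hcomp gr x d \<noteq> 0. hcomp gr x d)"
  unfolding hcomp_def by (rule theI'[OF gr_decomposition])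

lemma (in graded_vector_space) hcomp_in: "hcomp gr x d \<in> gr d"
  using hcomp_props[of x] by blast

lemma (in graded_vector_space) finite_hcomp: "finite {d. hcomp gr x d \<noteq> 0}"
  using hcomp_props[of x] by blast

lemma (in graded_vector_space) sum_hcomp: "(\<Sum>d | hcomp gr x d \<noteq> 0. hcomp gr x d) = x"
  using hcomp_props[of x] by metis

lemma (in graded_vector_space) hcomp_unique:
  assumes "\<And>d. f d \<in> gr d" "finite {d. f d \<noteq> 0}" "x = (\<Sum>d | f d \<noteq> 0. f d)"
  shows "hcomp gr x = f"
  unfolding hcomp_def by (rule the1_equality[OF gr_decomposition]) (use assms in simp)

lemma (in graded_vector_space) hcomp_homogeneous:
  assumes "x \<in> gr d"
  shows "hcomp gr x = (\<lambda>e. if e = d then x else 0)"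
proof (cases "x = 0")
  case True
  then show ?thesis by (intro hcomp_unique) (auto simp: subspace_0[OF gr_subspace])
next
  case False
  then have "{e. (if e = d then x else 0) \<noteq> 0} = {d}" by auto
  then show ?thesis using assms
    by (intro hcomp_unique) (auto simp: subspace_0[OF gr_subspace])
qed

lemma (in graded_vector_space) koszul_homogeneous:
  assumes "x \<in> gr d"
  shows "koszul gr x = (if even d then x else - x)"
proof (cases "x = 0")
  case False
  then have "{e. (if e = d then x else 0) \<noteq> 0} = {d}" by auto
  then show ?thesis by (simp add: koszul_def hcomp_homogeneous[OF assms])
qed (use assms in \<open>simp add: koszul_def hcomp_homogeneous\<close>)

lemma (in graded_vector_space) hcomp_diff:
  "hcomp gr (x - y) d = hcomp gr x d - hcomp gr y d"
proof -
  let ?f = "\<lambda>d. hcomp gr x d - hcomp gr y d"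
  let ?S = "{d. hcomp gr x d \<noteq> 0} \<union> {d. hcomp gr y d \<noteq> 0}"
  have fin: "finite ?S" using finite_hcomp by auto
  have "(\<Sum>d\<in>?S. hcomp gr x d) = x"
    by (subst sum_hcomp[of x, symmetric], rule sum.mono_neutral_right) (use fin in auto)
  moreover have "(\<Sum>d\<in>?S. hcomp gr y d) = y"
    by (subst sum_hcomp[of y, symmetric], rule sum.mono_neutral_right) (use fin in auto)
  ultimately have "x - y = (\<Sum>d\<in>?S. hcomp gr x d) - (\<Sum>d\<in>?S. hcomp gr y d)"
    by (simp only:)
  also have "\<dots> = (\<Sum>d\<in>?S. ?f d)" by (simp add: sum_subtractf)
  also have "\<dots> = (\<Sum>d | ?f d \<noteq> 0. ?f d)"
    by (rule sum.mono_neutral_right) (use fin in auto)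
  finally have "hcomp gr (x - y) = ?f"
  proof (intro hcomp_unique)
    show "?f d \<in> gr d" for d by (intro subspace_diff[OF gr_subspace] hcomp_in)
    show "finite {d. ?f d \<noteq> 0}" by (rule finite_subset[OF _ fin]) auto
  qed
  then show ?thesis by simp
qed

lemma filt_dist_less_iff:
  fixes F :: "nat \<Rightarrow> 'a::ab_group_add set"
  assumes dec: "\<And>k. 1 \<le> k \<Longrightarrow> F (Suc k) \<subseteq> F k" and one: "v - w \<in> F 1"
    and sep: "v \<noteq> w \<Longrightarrow> \<exists>k\<ge>1. v - w \<notin> F k" and zero: "0 \<in> F (Suc n)"
  shows "filt_dist F v w < 1 / 2 ^ n \<longleftrightarrow> v - w \<in> F (Suc n)"
proof (cases "v = w")
  case False
  have mono: "F l \<subseteq> F k" if "1 \<le> k" "k \<le> l" for k l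
    using that(2)
  proof (induction l rule: dec_induct)
    case (step n)
    then show ?case using dec[of n] that(1) by auto
  qed simp
  let ?S = "{k. 1 \<le> k \<and> v - w \<in> F k}"
  obtain m where "1 \<le> m" "v - w \<notin> F m" using sep[OF False] by blast
  then have "k \<le> m" if "k \<in> ?S" for k
    using mono[of m k] that by (cases "k \<le> m") auto
  then have "?S \<subseteq> {..m}" by blast
  then have fin: "finite ?S" using finite_subset by blast
  have ne: "1 \<in> ?S" using one by simp
  have M: "Max ?S \<in> ?S" using Max_in[OF fin] ne by blast
  have "filt_dist F v w < 1 / 2 ^ n \<longleftrightarrow> Suc n \<le> Max ?S"
    using False by (simp add: filt_dist_def field_simps Suc_le_eq)
  also have "\<dots> \<longleftrightarrow> v - w \<in> F (Suc n)"
  proof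
    assume "Suc n \<le> Max ?S"
    then show "v - w \<in> F (Suc n)" using mono[of "Suc n" "Max ?S"] M by auto
  next
    assume "v - w \<in> F (Suc n)"
    then show "Suc n \<le> Max ?S" by (intro Max_ge[OF fin]) auto
  qed
  finally show ?thesis .
qed (use zero in \<open>simp add: filt_dist_def\<close>)

lemma Metric_space_filt_dist:
  fixes F :: "nat \<Rightarrow> 'a::ab_group_add set"
  assumes dec: "\<And>k. 1 \<le> k \<Longrightarrow> F (Suc k) \<subseteq> F k"
    and zero: "\<And>k. 1 \<le> k \<Longrightarrow> 0 \<in> F k"
    and diff: "\<And>k v w. 1 \<le> k \<Longrightarrow> v \<in> F k \<Longrightarrow> w \<in> F k \<Longrightarrow> v - w \<in> F k"
    and one: "\<And>v w. v \<in> M \<Longrightarrow> w \<in> M \<Longrightarrow> v - w \<in> F 1"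
    and sep: "(\<Inter>k\<in>{1..}. F k) = {0}"
  shows "Metric_space M (filt_dist F)"
proof
  show "0 \<le> filt_dist F x y" for x y by (simp add: filt_dist_def)
  have neg: "- v \<in> F k" if "1 \<le> k" "v \<in> F k" for k v
    using diff[OF that(1) zero[OF that(1)] that(2)] by simp
  show "filt_dist F x y = filt_dist F y x" for x y
  proof -
    have "1 \<le> k \<and> x - y \<in> F k \<longleftrightarrow> 1 \<le> k \<and> y - x \<in> F k" for k
      using neg[of k "x - y"] neg[of k "y - x"] by auto
    then show ?thesis by (simp only: filt_dist_def eq_commute[of x y])
  qed
  show "(filt_dist F x y = 0) = (x = y)" for x y by (simp add: filt_dist_def)
  show "filt_dist F x z \<le> filt_dist F x y + filt_dist F y z"
    if "x \<in> M" "y \<in> M" "z \<in> M" for x y z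
  proof (cases "x = z")
    case False
    have sep': "\<exists>k\<ge>1. v - w \<notin> F k" if "v \<noteq> w" for v w
    proof (rule ccontr)
      assume "\<not> ?thesis"
      then have "v - w \<in> (\<Inter>k\<in>{1..}. F k)" by auto
      with that show False unfolding sep by simp
    qed
    note less = filt_dist_less_iff[OF dec one sep' zero]
    have "filt_dist F x z \<le> max (filt_dist F x y) (filt_dist F y z)"
    proof (rule ccontr)
      assume "\<not> ?thesis"
      then have lt: "filt_dist F x y < filt_dist F x z" "filt_dist F y z < filt_dist F x z"
        by auto
      obtain n where n: "filt_dist F x z = 1 / 2 ^ n"
        using False by (auto simp: filt_dist_def)
      have "x - y \<in> F (Suc n)" "y - z \<in> F (Suc n)"
        using lt less that unfolding n by auto
      then have "(x - y) - (- (y - z)) \<in> F (Suc n)"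
        by (intro diff[of "Suc n" "x - y"] neg[of "Suc n" "y - z"]) simp_all
      then have "filt_dist F x z < 1 / 2 ^ n" using less that by (simp add: algebra_simps)
      then show False using n by simp
    qed
    also have "\<dots> \<le> filt_dist F x y + filt_dist F y z"
      by (simp add: filt_dist_def)
    finally show ?thesis .
  qed (simp add: filt_dist_def)
qed

lemma (in graded_vector_space) mcomplete_gr_if_mcomplete_UNIV:
  assumes one: "F 1 = UNIV" and dec: "\<And>k. 1 \<le> k \<Longrightarrow> F (Suc k) \<subseteq> F k"
    and sub: "\<And>k. 1 \<le> k \<Longrightarrow> subspace (F k)"
    and grd: "\<And>k x d. 1 \<le> k \<Longrightarrow> x \<in> F k \<Longrightarrow> hcomp gr x d \<in> F k"
    and sep: "(\<Inter>k\<in>{1..}. F k) = {0}"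
    and complete: "Metric_space.mcomplete UNIV (filt_dist F)"
  shows "Metric_space.mcomplete (gr d) (filt_dist F)"
proof -
  have ms: "Metric_space M (filt_dist F)" for M
    using one dec sep subspace_0[OF sub] subspace_diff[OF sub]
    by (intro Metric_space_filt_dist) auto
  interpret U: Metric_space UNIV "filt_dist F" by (rule ms)
  interpret G: Metric_space "gr d" "filt_dist F" by (rule ms)
  have sep': "\<exists>k\<ge>1. v - w \<notin> F k" if "v \<noteq> w" for v w
  proof (rule ccontr)
    assume "\<not> ?thesis"
    then have "v - w \<in> (\<Inter>k\<in>{1..}. F k)" by auto
    with that show False unfolding sep by simp
  qed
  have less: "filt_dist F v w < 1 / 2 ^ n \<longleftrightarrow> v - w \<in> F (Suc n)" for v w n
    using dec one sep' subspace_0[OF sub] by (intro filt_dist_less_iff) auto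
  show ?thesis unfolding G.mcomplete_def
  proof (intro allI impI)
    fix s assume s: "G.MCauchy s"
    then have sg: "s n \<in> gr d" for n by (auto simp: G.MCauchy_def)
    from s have "U.MCauchy s" by (auto simp: G.MCauchy_def U.MCauchy_def)
    then obtain x where x: "limitin U.mtopology s x sequentially"
      using complete U.mcomplete_def by blast
    have comp0: "hcomp gr x e = 0" if "e \<noteq> d" for e
    proof -
      have "hcomp gr x e \<in> F k" if k: "1 \<le> k" for k
      proof -
        obtain n where n: "filt_dist F (s n) x < 1 / 2 ^ (k - 1)"
          using x unfolding U.limit_metric_sequentially
          by (metis order_refl zero_less_divide_1_iff zero_less_numeral zero_less_power)
        then have "s n - x \<in> F k" using less k by simp
        then have "hcomp gr (s n - x) e \<in> F k" by (rule grd[OF k])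
        then have "- hcomp gr x e \<in> F k"
          using \<open>e \<noteq> d\<close> by (simp add: hcomp_diff hcomp_homogeneous[OF sg])
        then show ?thesis using subspace_neg[OF sub[OF k]] by fastforce
      qed
      then have "hcomp gr x e \<in> (\<Inter>k\<in>{1..}. F k)" by auto
      then show ?thesis unfolding sep by simp
    qed
    have "x = (\<Sum>e\<in>{d}. hcomp gr x e)"
    proof -
      have "x = (\<Sum>e | hcomp gr x e \<noteq> 0. hcomp gr x e)" using sum_hcomp by metis
      also have "\<dots> = (\<Sum>e\<in>{d}. hcomp gr x e)"
        by (rule sum.mono_neutral_left) (use comp0 in auto)
      finally show ?thesis .
    qed
    then have "x \<in> gr d" using hcomp_in[of x d] by simp
    then have "limitin G.mtopology s x sequentially"
      using x sg unfolding U.limit_metric_sequentially G.limit_metric_sequentially by auto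
    then show "\<exists>x. limitin G.mtopology s x sequentially" by blast
  qed
qed

end

theory Submission
  imports Defs
begin

text \<open>A horn with missing face \<open>k\<close> is filled by putting \<open>0\<close> on the top simplex \<open>T\<close>. The Maurer-Cartan
  equation on \<open>T\<close> is then a fixed point equation for the value \<open>u\<close> on the missing face: apart from
  \<open>u\<close> itself, coming from the simplicial differential, \<open>u\<close> occurs only in operations with at least
  two arguments, which raise the filtration, so completeness gives a solution. That the
  Maurer-Cartan equation also holds on the missing face follows from the Bianchi identity on \<open>T\<close>: it
  expresses the curvature on this face through operations with that curvature as one of at least two
  arguments, hence the curvature lies in every filtration step. On degenerate simplices the
  curvature vanishes identically, so Maurer-Cartan elements can be pulled back along codegeneracies
  as well.\<close>

section \<open>Signs and boundaries\<close>

text \<open>The obstacle is the unary operation: it preserves the filtration without raising it, so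
  neither the equation for the missing value nor the Bianchi identity would gain anything if a unary
  operation reached the missing face. It cannot, because the only splitting of the top simplex into
  one piece is the top simplex itself; its value is prescribed, and its curvature is settled by the
  choice of the missing value. The missing value enters the boundary with coefficient
  \<open>(-1)^k\<close>, a unit in every characteristic, so the equation can be solved for it.

  Convergence is replaced by the statements \<open>curv Q y m \<tau> \<in> F m\<close> for all
  \<open>m \<ge> 1\<close>: operations with at least \<open>m\<close> arguments land in
  \<open>F m\<close> anyway, so finite sums suffice. An element of total degree 0 has degree
  \<open>-d\<close> on faces of dimension \<open>d\<close>; hence all Koszul signs depend on
  dimensions only and one change of signs absorbs them. Functions on arbitrary vertex lists,
  repeated vertices allowed, let the same identities serve for degenerate simplices.\<close>

definition alt :: "nat \<Rightarrow> 'a::ab_group_add \<Rightarrow> 'a" where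
  "alt n x = (if even n then x else - x)"

lemma alt_0 [simp]: "alt 0 x = x"
  and alt_Suc: "alt (Suc n) x = - alt n x"
  and alt_zero [simp]: "alt n 0 = 0"
  and alt_add: "alt n (x + y) = alt n x + alt n y"
  and alt_alt: "alt m (alt n x) = alt (m + n) x"
  and alt_minus: "alt n (- x) = - alt n x"
  and alt_diff: "alt n (x - y) = alt n x - alt n y"
  and alt_eq_0_iff: "alt n x = 0 \<longleftrightarrow> x = 0"
  by (auto simp: alt_def)

lemma alt_self [simp]: "alt n (alt n x) = x"
  by (simp add: alt_def)

lemma alt_sum: "alt n (sum f A) = (\<Sum>a\<in>A. alt n (f a))"
  by (simp add: alt_def sum_negf)

definition omit :: "nat \<Rightarrow> 'v list \<Rightarrow> 'v list" where
  "omit g \<tau> = take g \<tau> @ drop (Suc g) \<tau>"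

lemma length_omit: "g < length \<tau> \<Longrightarrow> length (omit g \<tau>) = length \<tau> - 1"
  by (simp add: omit_def)

lemma omit_0_Cons [simp]: "omit 0 (v # \<tau>) = \<tau>"
  and omit_Suc_Cons [simp]: "omit (Suc g) (v # \<tau>) = v # omit g \<tau>"
  by (simp_all add: omit_def)

text \<open>Defined on all lists, also those with repeated vertices. On a single vertex it returns
  \<open>f []\<close>, hence the recurring requirement that functions vanish on the empty
  list.\<close>

definition bd :: "('v list \<Rightarrow> 'a::ab_group_add) \<Rightarrow> 'v list \<Rightarrow> 'a" where
  "bd f \<tau> = (\<Sum>g<length \<tau>. alt g (f (omit g \<tau>)))"

lemma bd_Nil [simp]: "bd f [] = 0"
  by (simp add: bd_def)

lemma bd_Cons: "bd f (v # \<tau>) = f \<tau> - bd (\<lambda>\<sigma>. f (v # \<sigma>)) \<tau>"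
  unfolding bd_def length_Cons sum.lessThan_Suc_shift
  by (simp add: alt_Suc sum_negf)

lemma bd_diff: "bd (\<lambda>\<sigma>. f \<sigma> - g \<sigma>) \<tau> = bd f \<tau> - bd g \<tau>"
  by (simp add: bd_def alt_diff sum_subtractf)

lemma bd_add: "bd (\<lambda>\<sigma>. f \<sigma> + g \<sigma>) \<tau> = bd f \<tau> + bd g \<tau>"
  by (simp add: bd_def alt_add sum.distrib)

lemma bd_sum: "bd (\<lambda>\<sigma>. \<Sum>i\<in>I. f i \<sigma>) \<tau> = (\<Sum>i\<in>I. bd (f i) \<tau>)"
  unfolding bd_def alt_sum by (rule sum.swap)

text \<open>The usual pairing of double omissions is hidden in the recursion: after two uses of
  \<open>bd_Cons\<close> the terms \<open>bd f \<tau>\<close> cancel and only the double boundary of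
  \<open>\<lambda>\<sigma>. f (v # \<sigma>)\<close> remains.\<close>

lemma bd_bd: "bd (bd f) \<tau> = 0"
proof (induction \<tau> arbitrary: f)
  case (Cons v \<tau>)
  then show ?case by (simp add: bd_Cons bd_diff)
qed simp

section \<open>Overlapping splittings\<close>

text \<open>Consecutive pieces share one vertex, as for the cup product. Thus only a single vertex has a
  splitting into no pieces.\<close>

fun splits :: "nat \<Rightarrow> 'v list \<Rightarrow> 'v list list set" where
  "splits 0 \<tau> = (if length \<tau> = 1 then {[]} else {})"
| "splits (Suc l) \<tau> = (\<Union>j<length \<tau>. (#) (take (Suc j) \<tau>) ` splits l (drop j \<tau>))"

definition total_dim :: "'v list list \<Rightarrow> nat" where
  "total_dim \<rho> = (\<Sum>p\<leftarrow>\<rho>. length p - 1)"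

lemma total_dim_Nil [simp]: "total_dim [] = 0"
  and total_dim_Cons [simp]: "total_dim (p # \<rho>) = length p - 1 + total_dim \<rho>"
  by (simp_all add: total_dim_def)

lemma finite_splits [simp]: "finite (splits l \<tau>)"
  by (induction l \<tau> rule: splits.induct) auto

lemma splits_Nil [simp]: "splits l [] = {}"
  by (cases l) auto

lemma splits_one: "splits (Suc 0) \<tau> = (if \<tau> = [] then {} else {[\<tau>]})"
proof (cases "\<tau> = []")
  case False
  then have "{j. j < length \<tau> \<and> length \<tau> - j = 1} = {length \<tau> - 1}"
    by (cases \<tau>) auto
  moreover have "splits (Suc 0) \<tau> = (\<lambda>j. [take (Suc j) \<tau>]) ` {j. j < length \<tau> \<and> length \<tau> - j = 1}"
    by (auto split: if_splits)
  ultimately show ?thesis using False by simp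
qed simp

lemma length_splits: "\<rho> \<in> splits l \<tau> \<Longrightarrow> length \<rho> = l"
  by (induction l arbitrary: \<rho> \<tau>) (auto split: if_splits)

lemma total_dim_splits: "\<rho> \<in> splits l \<tau> \<Longrightarrow> total_dim \<rho> = length \<tau> - 1"
proof (induction l arbitrary: \<rho> \<tau>)
  case (Suc l)
  then obtain j \<rho>' where "j < length \<tau>" "\<rho>' \<in> splits l (drop j \<tau>)" "\<rho> = take (Suc j) \<tau> # \<rho>'"
    by auto
  with Suc.IH show ?case by fastforce
qed (auto split: if_splits)

lemma splits_piece:
  assumes "\<rho> \<in> splits l \<tau>" "p \<in> set \<rho>"
  shows "\<exists>i j. p = take (Suc i) (drop j \<tau>) \<and> p \<noteq> []"
  using assms
proof (induction l arbitrary: \<rho> \<tau>)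
  case (Suc l)
  then obtain j \<rho>' where j: "j < length \<tau>" "\<rho>' \<in> splits l (drop j \<tau>)" "\<rho> = take (Suc j) \<tau> # \<rho>'"
    by auto
  show ?case
  proof (cases "p = take (Suc j) \<tau>")
    case True
    then have "p = take (Suc j) (drop 0 \<tau>) \<and> p \<noteq> []" using j(1) by auto
    then show ?thesis by blast
  next
    case False
    with Suc.prems j Suc.IH[OF j(2)] show ?thesis by (auto simp: drop_drop)
  qed
qed (auto split: if_splits)

lemma sum_splits_Suc:
  "(\<Sum>\<rho>\<in>splits (Suc l) \<tau>. G \<rho>) = (\<Sum>j<length \<tau>. \<Sum>\<rho>\<in>splits l (drop j \<tau>). G (take (Suc j) \<tau> # \<rho>))"
proof -
  have "take (Suc i) \<tau> \<noteq> take (Suc j) \<tau>" if "i < length \<tau>" "j < length \<tau>" "i \<noteq> j" for i j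
  proof
    assume "take (Suc i) \<tau> = take (Suc j) \<tau>"
    then have "length (take (Suc i) \<tau>) = length (take (Suc j) \<tau>)" by simp
    with that show False by simp
  qed
  then have "(\<Sum>\<rho>\<in>splits (Suc l) \<tau>. G \<rho>)
      = (\<Sum>j<length \<tau>. sum G ((#) (take (Suc j) \<tau>) ` splits l (drop j \<tau>)))"
    unfolding splits.simps by (intro sum.UNION_disjoint) auto
  also have "\<dots> = (\<Sum>j<length \<tau>. \<Sum>\<rho>\<in>splits l (drop j \<tau>). G (take (Suc j) \<tau> # \<rho>))"
    by (rule sum.cong[OF refl], subst sum.reindex) (auto simp: inj_on_def)
  finally show ?thesis .
qed

lemma sum_triangle:
  fixes f :: "nat \<Rightarrow> nat \<Rightarrow> 'a::comm_monoid_add"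
  shows "(\<Sum>i<n. \<Sum>j<n - i. f i (i + j)) = (\<Sum>j<n. \<Sum>i<Suc j. f i j)"
proof -
  have "(\<Sum>i<n. \<Sum>j<n - i. f i (i + j)) = (\<Sum>i<n. \<Sum>j=i..<n. f i j)"
  proof (rule sum.cong[OF refl])
    show "(\<Sum>j<n - i. f i (i + j)) = (\<Sum>j=i..<n. f i j)" for i
      by (rule sum.reindex_bij_witness[of _ "\<lambda>j. j - i" "\<lambda>j. i + j"]) auto
  qed
  also have "\<dots> = (\<Sum>(i,j)\<in>(SIGMA i:{..<n}. {i..<n}). f i j)"
    by (subst sum.Sigma) auto
  also have "\<dots> = (\<Sum>(j,i)\<in>(SIGMA j:{..<n}. {..<Suc j}). f i j)"
    by (rule sum.reindex_bij_witness[of _ prod.swap prod.swap]) auto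
  also have "\<dots> = (\<Sum>j<n. \<Sum>i<Suc j. f i j)"
    by (subst sum.Sigma) auto
  finally show ?thesis .
qed

text \<open>A splitting into \<open>l + m\<close> pieces is cut at the vertex where its two halves
  meet; this vertex, of index \<open>j\<close>, belongs to both sublists.\<close>

lemma sum_splits_add:
  "(\<Sum>\<rho>\<in>splits (l + m) \<tau>. G \<rho>)
    = (\<Sum>j<length \<tau>. \<Sum>\<rho>\<in>splits l (take (Suc j) \<tau>). \<Sum>\<rho>'\<in>splits m (drop j \<tau>). G (\<rho> @ \<rho>'))"
proof (induction l arbitrary: G \<tau>)
  case 0
  show ?case
  proof (cases \<tau>)
    case (Cons v xs)
    \<comment> \<open>A sublist split into no pieces is a single vertex, so only
      \<open>j = 0\<close> contributes.\<close>
    have "(\<Sum>j<length \<tau>. \<Sum>\<rho>\<in>splits 0 (take (Suc j) \<tau>). \<Sum>\<rho>'\<in>splits m (drop j \<tau>). G (\<rho> @ \<rho>'))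
        = (\<Sum>j<length \<tau>. if j = 0 then \<Sum>\<rho>'\<in>splits m \<tau>. G \<rho>' else 0)"
      by (intro sum.cong refl) (auto simp: Cons)
    also have "\<dots> = (\<Sum>\<rho>'\<in>splits m \<tau>. G \<rho>')"
      using Cons by (subst sum.delta) auto
    finally show ?thesis by simp
  qed simp
next
  case (Suc l)
  let ?g = "\<lambda>i j. \<Sum>\<rho>\<in>splits l (drop i (take (Suc j) \<tau>)). \<Sum>\<rho>'\<in>splits m (drop j \<tau>).
     G (take (Suc i) \<tau> # \<rho> @ \<rho>')"
  have "(\<Sum>\<rho>\<in>splits (Suc l + m) \<tau>. G \<rho>) = (\<Sum>i<length \<tau>. \<Sum>j<length \<tau> - i. ?g i (i + j))"
    unfolding add_Suc sum_splits_Suc Suc.IH length_drop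
    by (intro sum.cong refl) (auto simp: drop_drop drop_take Suc_diff_le add.commute)
  also have "\<dots> = (\<Sum>j<length \<tau>. \<Sum>i<Suc j. ?g i j)"
    by (rule sum_triangle)
  also have "\<dots> = (\<Sum>j<length \<tau>. \<Sum>\<rho>\<in>splits (Suc l) (take (Suc j) \<tau>). \<Sum>\<rho>'\<in>splits m (drop j \<tau>).
      G (\<rho> @ \<rho>'))"
  proof (intro sum.cong refl)
    fix j assume "j \<in> {..<length \<tau>}"
    then have "length (take (Suc j) \<tau>) = Suc j" by simp
    then show "(\<Sum>i<Suc j. ?g i j) = (\<Sum>\<rho>\<in>splits (Suc l) (take (Suc j) \<tau>). \<Sum>\<rho>'\<in>splits m (drop j \<tau>).
      G (\<rho> @ \<rho>'))"
      unfolding sum_splits_Suc by (intro sum.cong) (auto simp: min_def)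
  qed
  finally show ?case .
qed

text \<open>An operation of odd degree acts on one piece of a splitting. The sign is the Koszul sign
  for passing the pieces before it, whose values will have degree minus their dimension.\<close>

definition marked_sum ::
    "nat \<Rightarrow> ('v list list \<Rightarrow> 'v list \<Rightarrow> 'v list list \<Rightarrow> 'a::ab_group_add) \<Rightarrow> 'v list \<Rightarrow> 'a" where
  "marked_sum l P \<tau> = (\<Sum>\<rho>\<in>splits l \<tau>. \<Sum>a<l.
     alt (total_dim (take a \<rho>)) (P (take a \<rho>) (\<rho> ! a) (drop (Suc a) \<rho>)))"

lemma marked_sum_0 [simp]: "marked_sum 0 P \<tau> = 0"
  by (simp add: marked_sum_def)

lemma marked_sum_Suc:
  "marked_sum (Suc l) P \<tau> = (\<Sum>j<length \<tau>. \<Sum>\<rho>\<in>splits l (drop j \<tau>). P [] (take (Suc j) \<tau>) \<rho>)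
    + (\<Sum>j<length \<tau>. alt j (marked_sum l (\<lambda>\<rho>. P (take (Suc j) \<tau> # \<rho>)) (drop j \<tau>)))"
proof -
  have "marked_sum (Suc l) P \<tau> = (\<Sum>j<length \<tau>. (\<Sum>\<rho>\<in>splits l (drop j \<tau>). P [] (take (Suc j) \<tau>) \<rho>)
     + alt j (marked_sum l (\<lambda>\<rho>. P (take (Suc j) \<tau> # \<rho>)) (drop j \<tau>)))"
    unfolding marked_sum_def sum_splits_Suc sum.lessThan_Suc_shift
  proof (rule sum.cong[OF refl])
    fix j assume "j \<in> {..<length \<tau>}"
    then have "length (take (Suc j) \<tau>) - 1 = j" by simp
    then show "(\<Sum>\<rho>\<in>splits l (drop j \<tau>).
          alt (total_dim (take 0 (take (Suc j) \<tau> # \<rho>)))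
            (P (take 0 (take (Suc j) \<tau> # \<rho>)) ((take (Suc j) \<tau> # \<rho>) ! 0)
              (drop (Suc 0) (take (Suc j) \<tau> # \<rho>)))
          + (\<Sum>a<l. alt (total_dim (take (Suc a) (take (Suc j) \<tau> # \<rho>)))
              (P (take (Suc a) (take (Suc j) \<tau> # \<rho>)) ((take (Suc j) \<tau> # \<rho>) ! Suc a)
                (drop (Suc (Suc a)) (take (Suc j) \<tau> # \<rho>)))))
        = (\<Sum>\<rho>\<in>splits l (drop j \<tau>). P [] (take (Suc j) \<tau>) \<rho>)
          + alt j (\<Sum>\<rho>\<in>splits l (drop j \<tau>). \<Sum>a<l. alt (total_dim (take a \<rho>))
              (P (take (Suc j) \<tau> # take a \<rho>) (\<rho> ! a) (drop (Suc a) \<rho>)))"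
      by (simp add: sum.distrib alt_sum alt_alt del: length_take)
  qed
  then show ?thesis by (simp only: sum.distrib)
qed

lemma marked_sum_add:
  "marked_sum l (\<lambda>\<rho> p \<rho>'. P \<rho> p \<rho>' + P' \<rho> p \<rho>') \<tau> = marked_sum l P \<tau> + marked_sum l P' \<tau>"
  by (simp add: marked_sum_def sum.distrib alt_add)

lemma marked_sum_sum:
  "marked_sum l (\<lambda>\<rho> p \<rho>'. \<Sum>b\<in>B. P b \<rho> p \<rho>') \<tau> = (\<Sum>b\<in>B. marked_sum l (P b) \<tau>)"
  unfolding marked_sum_def alt_sum
  by (subst sum.swap[of _ _ B], rule sum.cong[OF refl], subst sum.swap[of _ _ B]) simp

text \<open>Leibniz rule. Omitting a vertex interior to a piece, or an outer end of the whole list,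
  is an omission in exactly one piece. On the right there are also omissions of a shared vertex,
  from the end of one piece or from the start of the next; these yield the same lists with opposite
  signs and cancel. A one-vertex piece becomes empty, which the hypothesis on \<open>G\<close>
  discards.\<close>

lemma boundary_splits:
  assumes "\<And>\<rho>. [] \<in> set \<rho> \<Longrightarrow> G \<rho> = 0"
  shows "bd (\<lambda>\<sigma>. \<Sum>\<rho>\<in>splits l \<sigma>. G \<rho>) \<tau>
    = marked_sum l (\<lambda>\<rho> p \<rho>'. bd (\<lambda>q. G (\<rho> @ q # \<rho>')) p) \<tau>"
  using assms
proof (induction l arbitrary: G \<tau>)
  case 0
  show ?case
  proof (cases "length \<tau> = 2")
    case True
    then obtain u v where "\<tau> = [u, v]" by (metis length_0_conv length_Suc_conv numeral_2_eq_2)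
    then show ?thesis by (simp add: bd_Cons)
  qed (auto simp: bd_def length_omit)
next
  case (Suc l)
  show ?case
  proof (cases \<tau>)
    case (Cons v xs)
    define r where "r = length xs"
    have len: "length \<tau> = Suc r" by (simp add: Cons r_def)
    \<comment> \<open>\<open>H g j\<close> omits from a first piece ending at index
      \<open>Suc j\<close>, while \<open>K h j\<close> omits from the remainder starting at index
      \<open>j\<close>. The omissions of a shared vertex are \<open>H (Suc j) j\<close> and
      \<open>K 0 j\<close>, which cancel up to the sign \<open>alt j\<close>.\<close>
    define H where "H g j = (\<Sum>\<rho>\<in>splits l (drop (Suc j) \<tau>). alt g (G (omit g (take (Suc (Suc j)) \<tau>) # \<rho>)))" for g j
    define K where "K h j = (\<Sum>\<rho>\<in>splits l (omit h (drop j \<tau>)). G (take (Suc j) \<tau> # \<rho>))" for h j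
    have IH: "(\<Sum>h<Suc r - j. alt h (K h j))
        = marked_sum l (\<lambda>\<rho> p \<rho>'. bd (\<lambda>q. G (take (Suc j) \<tau> # \<rho> @ q # \<rho>')) p) (drop j \<tau>)" for j
      using Suc.IH[of "\<lambda>\<rho>. G (take (Suc j) \<tau> # \<rho>)" "drop j \<tau>"] Suc.prems
      by (simp add: bd_def K_def len)
    have "bd (\<lambda>\<sigma>. \<Sum>\<rho>\<in>splits (Suc l) \<sigma>. G \<rho>) \<tau> = (\<Sum>g<Suc r. \<Sum>j<r.
         alt g (\<Sum>\<rho>\<in>splits l (drop j (omit g \<tau>)). G (take (Suc j) (omit g \<tau>) # \<rho>)))"
      unfolding bd_def sum_splits_Suc len
      by (intro sum.cong refl) (simp add: length_omit len alt_sum)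
    also have "\<dots> = (\<Sum>j<r. \<Sum>g<Suc r. 
         alt g (\<Sum>\<rho>\<in>splits l (drop j (omit g \<tau>)). G (take (Suc j) (omit g \<tau>) # \<rho>)))"
      by (rule sum.swap)
    also have "\<dots> = (\<Sum>j<r. (\<Sum>g<Suc j. H g j) + (\<Sum>g=Suc j..<Suc r. alt g (K (g - j) j)))"
    proof (intro sum.cong refl)
      fix j assume "j \<in> {..<r}"
      then have j: "j < r" by simp
      have *: "{..<Suc r} = {..<Suc j} \<union> {Suc j..<Suc r}" using j by auto
      have 1: "take (Suc j) (omit g \<tau>) = omit g (take (Suc (Suc j)) \<tau>)" "drop j (omit g \<tau>) = drop (Suc j) \<tau>"
        if "g < Suc j" for g
        using that j len by (auto simp: omit_def take_drop min_def Suc_diff_le)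
      have 2: "take (Suc j) (omit g \<tau>) = take (Suc j) \<tau>" "drop j (omit g \<tau>) = omit (g - j) (drop j \<tau>)"
        if "Suc j \<le> g" "g < Suc r" for g
        using that j len by (auto simp: omit_def drop_take)
      show "(\<Sum>g<Suc r. alt g (\<Sum>\<rho>\<in>splits l (drop j (omit g \<tau>)). G (take (Suc j) (omit g \<tau>) # \<rho>)))
        = (\<Sum>g<Suc j. H g j) + (\<Sum>g=Suc j..<Suc r. alt g (K (g - j) j))"
        unfolding * 
        by (subst sum.union_disjoint) (auto intro!: arg_cong2[of _ _ _ _ "(+)"] sum.cong simp: 1 2 H_def K_def alt_sum)
    qed
    also have "\<dots> = (\<Sum>j<r. \<Sum>g<Suc j. H g j) + (\<Sum>j<r. \<Sum>g=Suc j..<Suc r. alt g (K (g - j) j))"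
      by (rule sum.distrib)
    also have "(\<Sum>j<r. \<Sum>g=Suc j..<Suc r. alt g (K (g - j) j))
        = (\<Sum>j<r. alt j (\<Sum>h<Suc r - j. alt h (K h j))) - (\<Sum>j<r. alt j (K 0 j))"
    proof (subst sum_subtractf[symmetric], intro sum.cong refl)
      fix j assume "j \<in> {..<r}"
      then have j: "Suc r - j = Suc (r - j)" "j \<le> r" by auto
      have "(\<Sum>g=Suc j..<Suc r. alt g (K (g - j) j)) = (\<Sum>h<r - j. alt (j + Suc h) (K (Suc h) j))"
        by (rule sum.reindex_bij_witness[of _ "\<lambda>h. j + Suc h" "\<lambda>g. g - Suc j"])
          (auto simp: Suc_diff_Suc Suc_diff_le)
      then show "(\<Sum>g=Suc j..<Suc r. alt g (K (g - j) j))
        = alt j (\<Sum>h<Suc r - j. alt h (K h j)) - alt j (K 0 j)"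
        unfolding j(1) sum.lessThan_Suc_shift by (simp add: alt_add alt_sum alt_alt)
    qed
    also have "(\<Sum>j<r. alt j (\<Sum>h<Suc r - j. alt h (K h j))) = (\<Sum>j<Suc r. alt j (\<Sum>h<Suc r - j. alt h (K h j)))"
    proof -
      \<comment> \<open>Here the remainder is the last vertex alone; omitting it leaves the empty
        list, which has no splittings.\<close>
      have "K 0 r = 0" using len by (simp add: K_def omit_def)
      then show ?thesis by simp
    qed
    also have "(\<Sum>j<r. \<Sum>g<Suc j. H g j) + ((\<Sum>j<Suc r. alt j (\<Sum>h<Suc r - j. alt h (K h j))) - (\<Sum>j<r. alt j (K 0 j)))
       = (\<Sum>j<Suc r. \<Sum>\<rho>\<in>splits l (drop j \<tau>). bd (\<lambda>q. G (q # \<rho>)) (take (Suc j) \<tau>))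
         + (\<Sum>j<Suc r. alt j (\<Sum>h<Suc r - j. alt h (K h j)))"
    proof -
      have "(\<Sum>j<Suc r. \<Sum>\<rho>\<in>splits l (drop j \<tau>). bd (\<lambda>q. G (q # \<rho>)) (take (Suc j) \<tau>))
        = (\<Sum>j<r. \<Sum>\<rho>\<in>splits l (drop (Suc j) \<tau>). bd (\<lambda>q. G (q # \<rho>)) (take (Suc (Suc j)) \<tau>))"
      proof -
        have "bd (\<lambda>q. G (q # \<rho>)) (take (Suc 0) \<tau>) = 0" for \<rho>
          using Suc.prems[of "[] # \<rho>"] by (simp add: Cons bd_Cons)
        then show ?thesis unfolding sum.lessThan_Suc_shift by simp
      qed
      also have "\<dots> = (\<Sum>j<r. (\<Sum>g<Suc j. H g j) - alt j (K 0 j))"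
      proof (intro sum.cong refl)
        fix j assume "j \<in> {..<r}"
        then have j: "Suc j < length \<tau>" using len by simp
        have e: "omit (Suc j) (take (Suc (Suc j)) \<tau>) = take (Suc j) \<tau>" "drop (Suc j) \<tau> = omit 0 (drop j \<tau>)"
          by (auto simp: omit_def)
        have "length (take (Suc (Suc j)) \<tau>) = Suc (Suc j)" using j by simp
        then have "(\<Sum>\<rho>\<in>splits l (drop (Suc j) \<tau>). bd (\<lambda>q. G (q # \<rho>)) (take (Suc (Suc j)) \<tau>))
          = (\<Sum>g<Suc (Suc j). H g j)"
          unfolding bd_def H_def by (subst sum.swap) simp
        moreover have "H (Suc j) j = - alt j (K 0 j)"
          unfolding H_def K_def e by (simp add: alt_Suc alt_sum sum_negf)
        ultimately show "(\<Sum>\<rho>\<in>splits l (drop (Suc j) \<tau>). bd (\<lambda>q. G (q # \<rho>)) (take (Suc (Suc j)) \<tau>))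
          = (\<Sum>g<Suc j. H g j) - alt j (K 0 j)" by simp
      qed
      finally show ?thesis by (simp add: sum_subtractf)
    qed
    finally show ?thesis unfolding marked_sum_Suc len IH by simp
  qed (simp add: marked_sum_def)
qed

text \<open>Splitting the marked piece of a coarse splitting into \<open>b\<close> pieces amounts to
  choosing \<open>b\<close> consecutive pieces of a splitting into \<open>N\<close>. The inner sum
  on the right has the shape of the A-infinity relation for one fine splitting;
  \<open>b = 0\<close>, where the marked piece is a single vertex, accounts for the curvature
  \<open>Q []\<close>.\<close>

lemma nested_splits:
  "(\<Sum>b\<le>N. marked_sum (Suc (N - b)) (\<lambda>\<rho> p \<rho>'. \<Sum>\<sigma>\<in>splits b p. R \<rho> \<sigma> \<rho>') \<tau>)
    = (\<Sum>\<rho>\<in>splits N \<tau>. \<Sum>b\<le>N. \<Sum>a\<le>N - b.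
        alt (total_dim (take a \<rho>)) (R (take a \<rho>) (take b (drop a \<rho>)) (drop (a + b) \<rho>)))"
proof (induction N arbitrary: R \<tau>)
  case 0
  show ?case unfolding marked_sum_def by (simp add: splits_one del: splits.simps(2))
next
  case (Suc N)
  \<comment> \<open>These are the terms whose marked piece comes first. In all others the first
    piece is split off and the induction hypothesis applies to the rest.\<close>
  have first: "(\<Sum>j<length \<tau>. \<Sum>\<rho>\<in>splits (Suc N - b) (drop j \<tau>). \<Sum>\<sigma>\<in>splits b (take (Suc j) \<tau>). R [] \<sigma> \<rho>)
      = (\<Sum>\<rho>\<in>splits (Suc N) \<tau>. R [] (take b \<rho>) (drop b \<rho>))" if "b \<le> Suc N" for b
  proof -
    have "(\<Sum>\<rho>\<in>splits (Suc N) \<tau>. R [] (take b \<rho>) (drop b \<rho>))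
      = (\<Sum>\<rho>\<in>splits (b + (Suc N - b)) \<tau>. R [] (take b \<rho>) (drop b \<rho>))"
      using that by simp
    also have "\<dots> = (\<Sum>j<length \<tau>. \<Sum>\<sigma>\<in>splits b (take (Suc j) \<tau>). \<Sum>\<rho>\<in>splits (Suc N - b) (drop j \<tau>). R [] \<sigma> \<rho>)"
      unfolding sum_splits_add by (intro sum.cong refl) (auto dest: length_splits)
    also have "\<dots> = (\<Sum>j<length \<tau>. \<Sum>\<rho>\<in>splits (Suc N - b) (drop j \<tau>). \<Sum>\<sigma>\<in>splits b (take (Suc j) \<tau>). R [] \<sigma> \<rho>)"
      by (intro sum.cong refl sum.swap)
    finally show ?thesis by simp
  qed
  let ?m = "\<lambda>j b. marked_sum (Suc N - b) (\<lambda>\<rho> p \<rho>'. \<Sum>\<sigma>\<in>splits b p. R (take (Suc j) \<tau> # \<rho>) \<sigma> \<rho>') (drop j \<tau>)"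
  let ?A = "\<lambda>\<rho> b a. alt (total_dim (take a \<rho>)) (R (take a \<rho>) (take b (drop a \<rho>)) (drop (a + b) \<rho>))"
  have "(\<Sum>b\<le>Suc N. \<Sum>j<length \<tau>. alt j (?m j b)) = (\<Sum>j<length \<tau>. alt j (\<Sum>b\<le>Suc N. ?m j b))"
    unfolding alt_sum by (rule sum.swap)
  also have "\<dots> = (\<Sum>j<length \<tau>. alt j (\<Sum>b\<le>N. marked_sum (Suc (N - b)) (\<lambda>\<rho> p \<rho>'. \<Sum>\<sigma>\<in>splits b p. R (take (Suc j) \<tau> # \<rho>) \<sigma> \<rho>') (drop j \<tau>)))"
    by (rule sum.cong[OF refl]) (simp add: Suc_diff_le)
  also have "\<dots> = (\<Sum>\<rho>\<in>splits (Suc N) \<tau>. \<Sum>b\<le>N. \<Sum>a\<le>N - b. ?A \<rho> b (Suc a))"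
    unfolding Suc.IH sum_splits_Suc alt_sum alt_alt by (intro sum.cong refl) (simp add: min_absorb2 Suc_leI)
  finally have second: "(\<Sum>b\<le>Suc N. \<Sum>j<length \<tau>. alt j (?m j b))
    = (\<Sum>\<rho>\<in>splits (Suc N) \<tau>. \<Sum>b\<le>N. \<Sum>a\<le>N - b. ?A \<rho> b (Suc a))" .
  have "(\<Sum>b\<le>Suc N. marked_sum (Suc (Suc N - b)) (\<lambda>\<rho> p \<rho>'. \<Sum>\<sigma>\<in>splits b p. R \<rho> \<sigma> \<rho>') \<tau>)
     = (\<Sum>b\<le>Suc N. \<Sum>\<rho>\<in>splits (Suc N) \<tau>. ?A \<rho> b 0) + (\<Sum>b\<le>Suc N. \<Sum>j<length \<tau>. alt j (?m j b))"
    unfolding marked_sum_Suc sum.distrib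
    by (intro arg_cong2[of _ _ _ _ "(+)"] refl sum.cong) (simp add: first)
  also have "\<dots> = (\<Sum>\<rho>\<in>splits (Suc N) \<tau>. (\<Sum>b\<le>Suc N. ?A \<rho> b 0) + (\<Sum>b\<le>N. \<Sum>a\<le>N - b. ?A \<rho> b (Suc a)))"
    unfolding second sum.distrib by (subst sum.swap) simp
  also have "\<dots> = (\<Sum>\<rho>\<in>splits (Suc N) \<tau>. \<Sum>b\<le>Suc N. \<Sum>a\<le>Suc N - b. ?A \<rho> b a)"
  proof (intro sum.cong refl)
    fix \<rho> assume "\<rho> \<in> splits (Suc N) \<tau>"
    have "(\<Sum>b\<le>N. \<Sum>a\<le>Suc N - b. ?A \<rho> b a) = (\<Sum>b\<le>N. ?A \<rho> b 0 + (\<Sum>a\<le>N - b. ?A \<rho> b (Suc a)))"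
      by (intro sum.cong refl) (simp only: Suc_diff_le sum.atMost_Suc_shift atMost_iff)
    then show "(\<Sum>b\<le>Suc N. ?A \<rho> b 0) + (\<Sum>b\<le>N. \<Sum>a\<le>N - b. ?A \<rho> b (Suc a)) = (\<Sum>b\<le>Suc N. \<Sum>a\<le>Suc N - b. ?A \<rho> b a)"
      by (simp add: sum.distrib algebra_simps)
  qed
  finally show ?case .
qed

section \<open>Curvature and the Bianchi identity\<close>

text \<open>The partial sums of the Maurer-Cartan equation on the simplex \<open>\<tau>\<close>, after the signs have been
  removed by \<open>twist\<close> below.\<close>

definition curv :: "('a::ab_group_add list \<Rightarrow> 'a) \<Rightarrow> ('v list \<Rightarrow> 'a) \<Rightarrow> nat \<Rightarrow> 'v list \<Rightarrow> 'a" where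
  "curv Q y m \<tau> = (\<Sum>l<m. \<Sum>\<rho>\<in>splits l \<tau>. Q (map y \<rho>)) + bd y \<tau>"

section \<open>Multilinearity, filtration and degree estimates for the operations\<close>

context complete_shifted_Ainf
begin

lemma Q_add: "Q (xs @ (x + y) # ys) = Q (xs @ x # ys) + Q (xs @ y # ys)"
  using Q_multilinear[of xs ys] by (simp add: Vector_Spaces.linear_iff)

lemma Q_zero: "Q (xs @ 0 # ys) = 0"
  using Q_add[of xs 0 0 ys] by simp

lemma Q_eq_0: "0 \<in> set xs \<Longrightarrow> Q xs = 0"
  by (auto simp: Q_zero dest: split_list)

lemma Q_minus: "Q (xs @ (- x) # ys) = - Q (xs @ x # ys)"
  using Q_add[of xs x "- x" ys] by (simp add: Q_zero eq_neg_iff_add_eq_0 add.commute)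

lemma Q_diff: "Q (xs @ (x - y) # ys) = Q (xs @ x # ys) - Q (xs @ y # ys)"
  using Q_add[of xs x "- y" ys] by (simp add: Q_minus)

lemma Q_alt: "Q (xs @ alt n x # ys) = alt n (Q (xs @ x # ys))"
  by (simp add: alt_def Q_minus)

lemma Q_sum: "Q (xs @ (\<Sum>i\<in>I. f i) # ys) = (\<Sum>i\<in>I. Q (xs @ f i # ys))"
  by (induction I rule: infinite_finite_induct) (simp_all add: Q_zero Q_add)

lemma Q_map_alt:
  "Q (zs @ map (\<lambda>j. alt (e j) (f j)) js @ ys) = alt (\<Sum>j\<leftarrow>js. e j) (Q (zs @ map f js @ ys))"
proof (induction js arbitrary: zs)
  case (Cons j js)
  have "Q (zs @ map (\<lambda>j. alt (e j) (f j)) (j # js) @ ys)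
      = alt (e j) (Q ((zs @ [f j]) @ map (\<lambda>j. alt (e j) (f j)) js @ ys))"
    using Q_alt[of zs "e j" "f j" "map (\<lambda>j. alt (e j) (f j)) js @ ys"] by simp
  then show ?case unfolding Cons.IH by (simp add: alt_alt)
qed simp

lemma F_mono: "1 \<le> i \<Longrightarrow> i \<le> j \<Longrightarrow> F j \<subseteq> F i"
proof (induction j)
  case (Suc j)
  then show ?case using F_decreasing[of j] by (cases "i = Suc j") auto
qed simp

lemma F_0: "1 \<le> k \<Longrightarrow> 0 \<in> F k"
  by (rule subspace_0[OF F_subspace])

lemma F_add: "1 \<le> k \<Longrightarrow> x \<in> F k \<Longrightarrow> y \<in> F k \<Longrightarrow> x + y \<in> F k"
  by (rule subspace_add[OF F_subspace])

lemma F_diff: "1 \<le> k \<Longrightarrow> x \<in> F k \<Longrightarrow> y \<in> F k \<Longrightarrow> x - y \<in> F k"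
  by (rule subspace_diff[OF F_subspace])

lemma F_sum: "1 \<le> k \<Longrightarrow> (\<And>i. i \<in> I \<Longrightarrow> f i \<in> F k) \<Longrightarrow> sum f I \<in> F k"
  by (rule subspace_sum[OF F_subspace])

lemma F_alt: "1 \<le> k \<Longrightarrow> alt n x \<in> F k \<longleftrightarrow> x \<in> F k"
  using subspace_neg[OF F_subspace, of k x] subspace_neg[OF F_subspace, of k "- x"]
  by (auto simp: alt_def)

lemma gr_alt: "alt n x \<in> gr d \<longleftrightarrow> x \<in> gr d"
  using subspace_neg[OF gr_subspace, of x d] subspace_neg[OF gr_subspace, of "- x" d]
  by (auto simp: alt_def)

text \<open>Every other argument lies in \<open>F 1\<close>, the whole space, and so adds one to the
  filtration. All convergence below comes from this gain.\<close>

lemma Q_in_F: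
  assumes "x \<in> F i" "1 \<le> i"
  shows "Q (xs @ x # ys) \<in> F (i + (length xs + length ys))"
proof -
  have "list_all2 (\<lambda>x i. 1 \<le> i \<and> x \<in> F i) zs (replicate (length zs) 1)" for zs
    using F_one by (auto simp: list_all2_conv_all_nth)
  then have "Q (xs @ x # ys) \<in> F (sum_list (replicate (length xs) 1 @ i # replicate (length ys) 1))"
    using assms by (intro F_Q list_all2_appendI) auto
  then show ?thesis by (simp add: sum_list_replicate ac_simps)
qed

lemma Q_in_F_length:
  assumes "xs \<noteq> []"
  shows "Q xs \<in> F (length xs)"
proof (cases xs)
  case (Cons x ys)
  then show ?thesis using Q_in_F[of x 1 "[]" ys] F_one by simp
qed (use assms in simp)

text \<open>The arguments are exchanged one at a time, the exchanged ones being collected in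
  \<open>zs\<close>; each difference has one argument in \<open>F i\<close> and \<open>l\<close>
  further ones.\<close>

lemma Q_diff_in_F:
  assumes "list_all2 (\<lambda>x x'. x - x' \<in> F i) xs xs'" "1 \<le> i" "length zs + length xs = Suc l"
  shows "Q (zs @ xs) - Q (zs @ xs') \<in> F (i + l)"
  using assms
proof (induction arbitrary: zs rule: list_all2_induct)
  case Nil
  then show ?case by (simp add: F_0)
next
  case (Cons x xs x' xs')
  have eq: "Q (zs @ x # xs) - Q (zs @ x' # xs') =
      Q (zs @ (x - x') # xs) + (Q ((zs @ [x']) @ xs) - Q ((zs @ [x']) @ xs'))"
    by (simp add: Q_diff)
  have "Q (zs @ (x - x') # xs) \<in> F (i + l)"
    using Q_in_F[of "x - x'" i zs xs] Cons.hyps Cons.prems by (simp add: add.commute)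
  moreover have "Q ((zs @ [x']) @ xs) - Q ((zs @ [x']) @ xs') \<in> F (i + l)"
    using Cons.prems by (intro Cons.IH) auto
  ultimately show ?case unfolding eq using Cons.prems by (intro F_add) simp_all
qed

lemma Q_splits_in_F: "1 \<le> m \<Longrightarrow> m \<le> l \<Longrightarrow> (\<Sum>\<rho>\<in>splits l \<tau>. Q (map y \<rho>)) \<in> F m"
proof (intro F_sum)
  fix \<rho> assume "1 \<le> m" "m \<le> l" "\<rho> \<in> splits l \<tau>"
  then show "Q (map y \<rho>) \<in> F m"
    using Q_in_F_length[of "map y \<rho>"] F_mono[of m l] length_splits[of \<rho> l \<tau>] by fastforce
qed

lemma curv_Suc: "curv Q y (Suc m) \<tau> = curv Q y m \<tau> + (\<Sum>\<rho>\<in>splits m \<tau>. Q (map y \<rho>))"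
  by (simp add: curv_def)

lemma Q_splits_in_gr:
  assumes "\<And>p. y p \<in> gr (- int (length p - 1))" "\<rho> \<in> splits l \<tau>"
  shows "Q (map y \<rho>) \<in> gr (1 - int (length \<tau> - 1))"
proof -
  have "list_all2 (\<lambda>x d. x \<in> gr d) (map y \<rho>) (map (\<lambda>p. - int (length p - 1)) \<rho>)"
    using assms(1) by (simp add: list.rel_map list_all2_same)
  moreover have "sum_list (map (\<lambda>p. - int (length p - 1)) \<rho>) = - int (total_dim \<rho>)"
    by (induction \<rho>) auto
  ultimately show ?thesis
    using Q_degree[of "map y \<rho>" "map (\<lambda>p. - int (length p - 1)) \<rho>"] total_dim_splits[OF assms(2)]
    by simp
qed

lemma bd_in_gr:
  assumes "\<And>p. y p \<in> gr (- int (length p - 1))" "2 \<le> length \<tau>"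
  shows "bd y \<tau> \<in> gr (1 - int (length \<tau> - 1))"
  unfolding bd_def
proof (intro subspace_sum[OF gr_subspace])
  fix g assume "g \<in> {..<length \<tau>}"
  then have "- int (length (omit g \<tau>) - 1) = 1 - int (length \<tau> - 1)"
    using assms(2) by (simp add: length_omit)
  then show "alt g (y (omit g \<tau>)) \<in> gr (1 - int (length \<tau> - 1))"
    using assms(1)[of "omit g \<tau>"] by (simp add: gr_alt)
qed

text \<open>On values of degree minus the dimension, \<open>koszul\<close> is the sign of the
  dimension, so the A-infinity relations carry exactly the signs of
  \<open>marked_sum\<close>.\<close>

lemma Q_relations_alt:
  assumes "\<And>p. y p \<in> gr (- int (length p - 1))"
  shows "(\<Sum>b\<le>length \<rho>. \<Sum>a\<le>length \<rho> - b. alt (total_dim (take a \<rho>))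
     (Q (map y (take a \<rho>) @ Q (map y (take b (drop a \<rho>))) # map y (drop (a + b) \<rho>)))) = 0"
proof -
  let ?n = "length \<rho>"
  have k: "koszul gr (y p) = alt (length p - 1) (y p)" for p
    by (simp add: koszul_homogeneous[OF assms] alt_def)
  have "Q (map (koszul gr) (take a (map y \<rho>)) @ Q (take b (drop a (map y \<rho>))) # drop (a + b) (map y \<rho>))
     = alt (total_dim (take a \<rho>))
         (Q (map y (take a \<rho>) @ Q (map y (take b (drop a \<rho>))) # map y (drop (a + b) \<rho>)))" for a b
    using Q_map_alt[of "[]" "\<lambda>p. length p - 1" y "take a \<rho>"]
    by (simp add: k take_map drop_map total_dim_def comp_def)
  then have "(\<Sum>(a, b) | a + b \<le> ?n. alt (total_dim (take a \<rho>))
     (Q (map y (take a \<rho>) @ Q (map y (take b (drop a \<rho>))) # map y (drop (a + b) \<rho>)))) = 0"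
    using Q_relations[of "map y \<rho>"] by simp
  moreover have "(\<Sum>(a, b) | a + b \<le> ?n. f a b) = (\<Sum>b\<le>?n. \<Sum>a\<le>?n - b. f a b)" for f :: "nat \<Rightarrow> nat \<Rightarrow> 'a"
    by (subst sum.Sigma, simp, simp, rule sum.reindex_bij_witness[of _ prod.swap prod.swap]) auto
  ultimately show ?thesis by simp
qed

text \<open>Curvatures satisfy the Bianchi identity. The truncation orders are balanced so that it holds
  exactly, not only in the limit.\<close>

lemma bianchi:
  assumes y_Nil: "y [] = 0" and y_gr: "\<And>p. y p \<in> gr (- int (length p - 1))"
  shows "(\<Sum>l<M. marked_sum (Suc l) (\<lambda>\<rho> p \<rho>'. Q (map y \<rho> @ curv Q y (M - l) p # map y \<rho>')) \<tau>)
    = bd (curv Q y (Suc M)) \<tau>"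
proof -
  define f where "f l b = marked_sum (Suc l) (\<lambda>\<rho> p \<rho>'. \<Sum>\<sigma>\<in>splits b p.
      Q (map y \<rho> @ Q (map y \<sigma>) # map y \<rho>')) \<tau>" for l b
  have G0: "Q (map y \<rho>) = 0" if "[] \<in> set \<rho>" for \<rho>
    using that y_Nil by (intro Q_eq_0) force
  have bnd: "bd (\<lambda>\<sigma>. \<Sum>\<rho>\<in>splits l \<sigma>. Q (map y \<rho>)) \<tau>
      = marked_sum l (\<lambda>\<rho> p \<rho>'. Q (map y \<rho> @ bd y p # map y \<rho>')) \<tau>" for l
  proof -
    have "bd (\<lambda>\<sigma>. \<Sum>\<rho>\<in>splits l \<sigma>. Q (map y \<rho>)) \<tau>
        = marked_sum l (\<lambda>\<rho> p \<rho>'. bd (\<lambda>q. Q (map y (\<rho> @ q # \<rho>'))) p) \<tau>"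
      by (rule boundary_splits) (rule G0)
    then show ?thesis by (simp add: bd_def Q_sum Q_alt)
  qed
  have "(\<Sum>l<M. marked_sum (Suc l) (\<lambda>\<rho> p \<rho>'. Q (map y \<rho> @ curv Q y (M - l) p # map y \<rho>')) \<tau>)
    = (\<Sum>l<M. \<Sum>b<M - l. f l b) + (\<Sum>l<M. bd (\<lambda>\<sigma>. \<Sum>\<rho>\<in>splits (Suc l) \<sigma>. Q (map y \<rho>)) \<tau>)"
    unfolding bnd f_def curv_def Q_add Q_sum marked_sum_add marked_sum_sum sum.distrib ..
  \<comment> \<open>Regrouped by the number \<open>N = l + b\<close> of fine pieces: the truncation
    \<open>M - l\<close> of the inner curvature makes the index set the triangle
    \<open>N < M\<close>, so for each \<open>N\<close> the A-infinity relation occurs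
    complete.\<close>
  also have "(\<Sum>l<M. \<Sum>b<M - l. f l b) = (\<Sum>N<M. \<Sum>l<Suc N. f l (N - l))"
    using sum_triangle[of "\<lambda>l N. f l (N - l)" M] by simp
  also have "\<dots> = 0"
  proof (rule sum.neutral, rule ballI)
    fix N
    have "(\<Sum>l<Suc N. f l (N - l)) = (\<Sum>b\<le>N. f (N - b) b)"
      by (rule sum.reindex_bij_witness[of _ "\<lambda>b. N - b" "\<lambda>b. N - b"]) auto
    also have "\<dots> = (\<Sum>\<rho>\<in>splits N \<tau>. \<Sum>b\<le>N. \<Sum>a\<le>N - b. alt (total_dim (take a \<rho>))
       (Q (map y (take a \<rho>) @ Q (map y (take b (drop a \<rho>))) # map y (drop (a + b) \<rho>))))"
      unfolding f_def by (rule nested_splits)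
    also have "\<dots> = 0"
      by (rule sum.neutral) (use Q_relations_alt[OF y_gr] length_splits in blast)
    finally show "(\<Sum>l<Suc N. f l (N - l)) = 0" .
  qed
  \<comment> \<open>By \<open>bnd\<close> splittings into no pieces have zero boundary, so the index
    may start at 0; the boundary term of the curvature drops out by \<open>bd_bd\<close>.\<close>
  also have "0 + (\<Sum>l<M. bd (\<lambda>\<sigma>. \<Sum>\<rho>\<in>splits (Suc l) \<sigma>. Q (map y \<rho>)) \<tau>)
     = (\<Sum>l<Suc M. bd (\<lambda>\<sigma>. \<Sum>\<rho>\<in>splits l \<sigma>. Q (map y \<rho>)) \<tau>)"
    unfolding sum.lessThan_Suc_shift bnd[of 0] by simp
  also have "\<dots> = bd (curv Q y (Suc M)) \<tau>"
    by (simp only: curv_def[abs_def] bd_add bd_sum bd_bd) simp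
  finally show ?thesis .
qed

text \<open>Since a splitting of \<open>\<tau>\<close> into more than one piece has further arguments, the Bianchi identity
  improves the filtration degree of the one unknown curvature at each step.\<close>

lemma curv_missing_face:
  assumes y_Nil: "y [] = 0" and y_gr: "\<And>p. y p \<in> gr (- int (length p - 1))"
    and k: "k < length \<tau>"
    and pieces: "\<And>i j m. take (Suc i) (drop j \<tau>) \<noteq> [] \<Longrightarrow> take (Suc i) (drop j \<tau>) \<noteq> omit k \<tau> \<Longrightarrow>
      1 \<le> m \<Longrightarrow> curv Q y m (take (Suc i) (drop j \<tau>)) \<in> F m"
    and faces: "\<And>g m. g < length \<tau> \<Longrightarrow> g \<noteq> k \<Longrightarrow> 1 \<le> m \<Longrightarrow> curv Q y m (omit g \<tau>) \<in> F m"
    and "1 \<le> m"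
  shows "curv Q y m (omit k \<tau>) \<in> F m"
proof -
  \<comment> \<open>Induction on the precision \<open>i\<close>. The order \<open>m\<close> stays
    free because an outer operation with \<open>Suc l\<close> arguments contains the curvature of
    order \<open>m - l\<close>, and the minimum records that order \<open>m\<close> gives no
    information beyond \<open>F m\<close>.\<close>
  have "curv Q y m (omit k \<tau>) \<in> F (min (Suc i) m)" if "1 \<le> m" for i m
    using that
  proof (induction i arbitrary: m)
    case 0
    then show ?case using F_one by (simp add: min_def)
  next
    case (Suc i)
    let ?n = "min (Suc (Suc i)) m"
    have n: "1 \<le> ?n" using Suc.prems by simp
    have "Q (map y (take a \<rho>) @ curv Q y (m - l) (\<rho> ! a) # map y (drop (Suc a) \<rho>)) \<in> F ?n"
      if l: "l < m" and \<rho>: "\<rho> \<in> splits (Suc l) \<tau>" and a: "a < Suc l" for l \<rho> a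
    proof -
      have len: "length \<rho> = Suc l" using \<rho> by (rule length_splits)
      have "\<exists>j\<ge>1. ?n \<le> j + l \<and> curv Q y (m - l) (\<rho> ! a) \<in> F j"
      proof (cases "\<rho> ! a = omit k \<tau>")
        case True
        \<comment> \<open>For \<open>l = 0\<close> the only piece is \<open>\<tau>\<close>, which is
          too long to be the missing face. Hence there is at least one further argument and a
          filtration step is gained.\<close>
        have "l \<noteq> 0"
        proof
          assume "l = 0"
          then have "\<rho> ! a = \<tau>"
            using \<rho> a splits_one[of \<tau>] by (auto split: if_splits simp del: splits.simps(2))
          then show False using True length_omit[OF k] k by simp
        qed
        then show ?thesis
          using Suc.IH[of "m - l"] l True by (intro exI[of _ "min (Suc i) (m - l)"]) auto
      next
        case False
        have "\<rho> ! a \<in> set \<rho>" using len a by simp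
        then obtain i' j' where "\<rho> ! a = take (Suc i') (drop j' \<tau>)" "\<rho> ! a \<noteq> []"
          using splits_piece[OF \<rho>] by blast
        then have "curv Q y (m - l) (\<rho> ! a) \<in> F (m - l)"
          using pieces[of i' j' "m - l"] False l by simp
        then show ?thesis using l by (intro exI[of _ "m - l"]) auto
      qed
      then obtain j where j: "1 \<le> j" "?n \<le> j + l" "curv Q y (m - l) (\<rho> ! a) \<in> F j" by blast
      have "Q (map y (take a \<rho>) @ curv Q y (m - l) (\<rho> ! a) # map y (drop (Suc a) \<rho>)) \<in> F (j + l)"
        using Q_in_F[OF j(3,1), of "map y (take a \<rho>)" "map y (drop (Suc a) \<rho>)"] len a
        by (simp add: min_def)
      then show ?thesis using F_mono[OF n j(2)] by blast
    qed
    then have "bd (curv Q y (Suc m)) \<tau> \<in> F ?n"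
      unfolding bianchi[OF y_Nil y_gr, symmetric] marked_sum_def
      by (intro F_sum n) (simp add: F_alt[OF n])
    moreover have "(\<Sum>g\<in>{..<length \<tau>} - {k}. alt g (curv Q y (Suc m) (omit g \<tau>))) \<in> F ?n"
    proof (intro F_sum n)
      fix g assume "g \<in> {..<length \<tau>} - {k}"
      then have "curv Q y (Suc m) (omit g \<tau>) \<in> F (Suc m)" by (intro faces) auto
      moreover have "F (Suc m) \<subseteq> F ?n" by (rule F_mono[OF n]) simp
      ultimately show "alt g (curv Q y (Suc m) (omit g \<tau>)) \<in> F ?n" by (auto simp: F_alt[OF n])
    qed
    moreover have "bd (curv Q y (Suc m)) \<tau> = alt k (curv Q y (Suc m) (omit k \<tau>)) +
        (\<Sum>g\<in>{..<length \<tau>} - {k}. alt g (curv Q y (Suc m) (omit g \<tau>)))"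
      unfolding bd_def using k by (subst sum.remove[of _ k]) auto
    ultimately have "alt k (curv Q y (Suc m) (omit k \<tau>)) \<in> F ?n"
      using F_diff[OF n] by (metis add_diff_cancel_right')
    then have "curv Q y (Suc m) (omit k \<tau>) \<in> F ?n" by (simp add: F_alt[OF n])
    \<comment> \<open>The Bianchi identity speaks of order \<open>Suc m\<close>; the summand that
      separates it from order \<open>m\<close> has \<open>m\<close> arguments.\<close>
    moreover have "(\<Sum>\<rho>\<in>splits m (omit k \<tau>). Q (map y \<rho>)) \<in> F ?n"
      using n by (intro Q_splits_in_F) auto
    ultimately show ?case
      using F_diff[OF n] by (metis curv_Suc add_diff_cancel_right')
  qed
  from this[of m m] \<open>1 \<le> m\<close> show ?thesis by (simp add: min_def)
qed

section \<open>Completeness and the solution of the equation on the top simplex\<close>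

lemma Metric_space_gr: "Metric_space M (filt_dist F)"
  using F_decreasing F_0 F_diff F_one F_separated by (intro Metric_space_filt_dist) auto

lemma ex_not_in_F: "v \<noteq> w \<Longrightarrow> \<exists>k\<ge>1. v - w \<notin> F k"
  using F_separated by (metis (no_types, lifting) INT_I atLeast_iff right_minus_eq singletonD)

text \<open>Completeness in one degree, translated from the metric into filtration steps. The rate
  is kept: the limit agrees with \<open>s m\<close> modulo \<open>F m\<close>.\<close>

lemma ex_limit:
  assumes gr: "\<And>m. s m \<in> gr d" and cauchy: "\<And>m. 1 \<le> m \<Longrightarrow> s (Suc m) - s m \<in> F m"
  shows "\<exists>u\<in>gr d. \<forall>m\<ge>1. u - s m \<in> F m"
proof -
  interpret Metric_space "gr d" "filt_dist F" by (rule Metric_space_gr)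
  have less: "filt_dist F v w < 1 / 2 ^ n \<longleftrightarrow> v - w \<in> F (Suc n)" for v w n
    using F_decreasing F_one ex_not_in_F F_0 by (intro filt_dist_less_iff) auto
  have tail: "s (m + i) - s m \<in> F m" if "1 \<le> m" for m i
  proof (induction i)
    case (Suc i)
    have "s (Suc (m + i)) - s (m + i) \<in> F m"
      using cauchy[of "m + i"] F_mono[of m "m + i"] that by auto
    from F_add[OF that this Suc] show ?case by simp
  qed (use that in \<open>simp add: F_0\<close>)
  have "MCauchy s"
    unfolding MCauchy_def
  proof (intro conjI allI impI)
    fix e :: real assume "0 < e"
    then obtain n where n: "1 / 2 ^ n < e"
      using real_arch_pow_inv[of e "1/2"] by (auto simp: power_divide)
    have "filt_dist F (s i) (s j) < e" if "Suc n \<le> i" "Suc n \<le> j" for i j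
    proof -
      have "s i - s (Suc n) \<in> F (Suc n)" "s j - s (Suc n) \<in> F (Suc n)"
        using tail[of "Suc n" "i - Suc n"] tail[of "Suc n" "j - Suc n"] that by auto
      from F_diff[OF _ this] have "filt_dist F (s i) (s j) < 1 / 2 ^ n"
        by (simp add: less)
      with n show ?thesis by simp
    qed
    then show "\<exists>N. \<forall>i j. N \<le> i \<longrightarrow> N \<le> j \<longrightarrow> filt_dist F (s i) (s j) < e" by blast
  qed (use gr in auto)
  then obtain u where u: "limitin mtopology s u sequentially"
    using F_complete[of d] unfolding mcomplete_def by blast
  have "u - s m \<in> F m" if "1 \<le> m" for m
  proof -
    obtain N where N: "\<And>i. N \<le> i \<Longrightarrow> filt_dist F (s i) u < 1 / 2 ^ (m - 1)"
      using u unfolding limit_metric_sequentially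
      by (metis zero_less_divide_1_iff zero_less_numeral zero_less_power)
    have "s (m + N) - u \<in> F m" using N[of "m + N"] that by (simp add: less)
    from F_diff[OF that tail[OF that] this, of N] show ?thesis by simp
  qed
  moreover have "u \<in> gr d" using u unfolding limit_metric_sequentially by blast
  ultimately show ?thesis by blast
qed

text \<open>Up to sign the curvature on \<open>\<tau>\<close> is \<open>u - \<Phi> m u\<close>, and
  \<open>\<Phi> m\<close> gains one filtration step on differences. A single limit of iterates then
  solves the equation to order \<open>m\<close> for every \<open>m\<close>.\<close>

lemma ex_curv_filler:
  assumes z_gr: "\<And>p. z p \<in> gr (- int (length p - 1))" and z_\<tau>: "z \<tau> = 0"
    and \<tau>: "distinct \<tau>" "2 \<le> length \<tau>" "k < length \<tau>"
  shows "\<exists>u\<in>gr (- int (length (omit k \<tau>) - 1)). \<forall>m\<ge>1. curv Q (z(omit k \<tau> := u)) m \<tau> \<in> F m"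
proof -
  define \<sigma> where "\<sigma> = omit k \<tau>"
  define d where "d = - int (length \<sigma> - 1)"
  define C where "C l u = (\<Sum>\<rho>\<in>splits l \<tau>. Q (map (z(\<sigma> := u)) \<rho>))" for l u
  define w where "w = bd (z(\<sigma> := 0)) \<tau>"
  \<comment> \<open>Obtained by solving for the \<open>u\<close> that the boundary contributes as
    \<open>alt k u\<close>; \<open>w\<close> collects the other faces.\<close>
  define \<Phi> where "\<Phi> m u = - alt k ((\<Sum>l<m. C l u) + w)" for m u
  have len: "length \<sigma> = length \<tau> - 1" unfolding \<sigma>_def using \<tau>(3) by (rule length_omit)
  have d: "d = 1 - int (length \<tau> - 1)" using \<tau>(2) len by (simp add: d_def)
  have ne: "\<tau> \<noteq> \<sigma>" using len \<tau>(2) by auto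
  \<comment> \<open>The vertices are distinct, so \<open>u\<close> enters the boundary only through
    the omission of the vertex at position \<open>k\<close>.\<close>
  have omit_ne: "omit g \<tau> \<noteq> \<sigma>" if "g < length \<tau>" "g \<noteq> k" for g
  proof -
    have "set (omit g \<tau>) = set \<tau> - {\<tau> ! g}" if "g < length \<tau>" for g
    proof -
      have "\<tau> = take g \<tau> @ \<tau> ! g # drop (Suc g) \<tau>" using that by (rule id_take_nth_drop)
      then have "set \<tau> = insert (\<tau> ! g) (set (omit g \<tau>))" "\<tau> ! g \<notin> set (omit g \<tau>)"
        unfolding omit_def using \<tau>(1)
        by (metis list.set(2) set_append Un_insert_right, metis not_distinct_conv_prefix
            distinct_append distinct.simps(2) Un_iff set_append disjoint_insert(1))
      then show ?thesis by auto
    qed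
    moreover have "\<tau> ! g \<noteq> \<tau> ! k" using that \<tau> by (simp add: nth_eq_iff_index_eq)
    ultimately show ?thesis
      using that \<tau>(3) nth_mem[of g \<tau>] nth_mem[of k \<tau>] unfolding \<sigma>_def by (metis Diff_iff empty_iff insert_iff)
  qed
  have bd_upd: "bd (z(\<sigma> := u)) \<tau> = w + alt k u" for u
  proof -
    have "bd (z(\<sigma> := u)) \<tau> = alt k u + (\<Sum>g\<in>{..<length \<tau>} - {k}. alt g (z (omit g \<tau>)))" for u
      unfolding bd_def using \<tau>(3)
      by (subst sum.remove[of _ k]) (auto simp: \<sigma>_def[symmetric] omit_ne intro!: sum.cong)
    from this[of u] this[of 0] show ?thesis unfolding w_def by simp
  qed
  have curv_eq: "curv Q (z(\<sigma> := u)) m \<tau> = alt k (u - \<Phi> m u)" for u m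
    unfolding curv_def bd_upd \<Phi>_def C_def by (simp add: alt_diff alt_minus alt_add)
  have upd_gr: "(z(\<sigma> := u)) p \<in> gr (- int (length p - 1))" if "u \<in> gr d" for u p
    using that z_gr by (auto simp: d_def)
  have \<Phi>_gr: "\<Phi> m u \<in> gr d" if "u \<in> gr d" for m u
  proof -
    have "C l u \<in> gr d" for l
      unfolding C_def d using Q_splits_in_gr[OF upd_gr[OF that]]
      by (intro subspace_sum[OF gr_subspace])
    moreover have "w \<in> gr d"
      unfolding w_def d using \<tau>(2) by (intro bd_in_gr upd_gr) (simp add: subspace_0[OF gr_subspace])
    ultimately show ?thesis unfolding \<Phi>_def
      by (intro subspace_neg[OF gr_subspace] subspace_add[OF gr_subspace] subspace_sum[OF gr_subspace])
        (simp add: gr_alt, intro subspace_add[OF gr_subspace] subspace_sum[OF gr_subspace])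
  qed
  have C_contract: "C l u - C l u' \<in> F (Suc i)" if "u - u' \<in> F i" "1 \<le> i" for l u u' i
    unfolding C_def sum_subtractf[symmetric]
  proof (rule F_sum)
    fix \<rho> assume \<rho>: "\<rho> \<in> splits l \<tau>"
    have lr: "length \<rho> = l" using \<rho> by (rule length_splits)
    \<comment> \<open>With no argument there is no \<open>u\<close>; the single piece is
      \<open>\<tau>\<close>, where the value does not depend on \<open>u\<close>; from two arguments
      on, the second one provides the extra filtration step.\<close>
    consider "l = 0" | "l = 1" | "2 \<le> l" by linarith
    then show "Q (map (z(\<sigma> := u)) \<rho>) - Q (map (z(\<sigma> := u')) \<rho>) \<in> F (Suc i)"
    proof cases
      case 1
      then show ?thesis using lr by (simp add: F_0)
    next
      case 2
      then have "\<rho> = [\<tau>]" using \<rho> by (auto simp: splits_one split: if_splits simp del: splits.simps(2))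
      then show ?thesis using ne by (simp add: F_0)
    next
      case 3
      have "list_all2 (\<lambda>x x'. x - x' \<in> F i) (map (z(\<sigma> := u)) \<rho>) (map (z(\<sigma> := u')) \<rho>)"
        using that by (auto simp: list.rel_map list_all2_same F_0)
      from Q_diff_in_F[OF this that(2), of "[]" "l - 1"] 3 lr
      have "Q (map (z(\<sigma> := u)) \<rho>) - Q (map (z(\<sigma> := u')) \<rho>) \<in> F (i + (l - 1))" by simp
      moreover have "F (i + (l - 1)) \<subseteq> F (Suc i)" by (rule F_mono) (use 3 in auto)
      ultimately show ?thesis by blast
    qed
  qed simp
  have \<Phi>_contract: "\<Phi> m u - \<Phi> m u' \<in> F (Suc i)" if "u - u' \<in> F i" "1 \<le> i" for m u u' i
  proof -
    have "\<Phi> m u - \<Phi> m u' = - alt k (\<Sum>l<m. C l u - C l u')"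
      by (simp add: \<Phi>_def sum_subtractf alt_diff alt_add)
    also have "\<dots> = alt (Suc k) (\<Sum>l<m. C l u - C l u')" by (simp add: alt_Suc)
    also have "\<dots> \<in> F (Suc i)" using C_contract[OF that] by (simp add: F_alt F_sum)
    finally show ?thesis .
  qed
  have \<Phi>_Suc: "\<Phi> (Suc m) u - \<Phi> m u \<in> F m" if "1 \<le> m" for m u
  proof -
    have "\<Phi> (Suc m) u - \<Phi> m u = alt (Suc k) (C m u)"
      by (simp add: \<Phi>_def alt_add alt_Suc)
    also have "\<dots> \<in> F m" using that Q_splits_in_F[of m m] by (simp add: F_alt C_def)
    finally show ?thesis .
  qed
  \<comment> \<open>Fixed point iteration in which the truncation order grows along with the
    precision reached.\<close>
  define s where "s = rec_nat 0 (\<lambda>m u. \<Phi> (Suc m) u)"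
  have s: "s 0 = 0" "s (Suc m) = \<Phi> (Suc m) (s m)" for m by (simp_all add: s_def)
  have s_gr: "s m \<in> gr d" for m
    by (induction m) (auto simp: s subspace_0[OF gr_subspace] \<Phi>_gr)
  have s_cauchy: "s (Suc m) - s m \<in> F m" if "1 \<le> m" for m
    using that
  proof (induction m rule: dec_induct)
    case base
    then show ?case using F_one by simp
  next
    case (step m)
    have "s (Suc (Suc m)) - s (Suc m) = (\<Phi> (Suc (Suc m)) (s (Suc m)) - \<Phi> (Suc m) (s (Suc m)))
       + (\<Phi> (Suc m) (s (Suc m)) - \<Phi> (Suc m) (s m))" by (simp add: s)
    also have "\<dots> \<in> F (Suc m)" using step by (intro F_add \<Phi>_Suc \<Phi>_contract) auto
    finally show ?case .
  qed
  from ex_limit[of s, OF s_gr s_cauchy]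
  obtain u where u: "u \<in> gr d" "\<And>m. 1 \<le> m \<Longrightarrow> u - s m \<in> F m" by blast
  have "u - \<Phi> m u \<in> F m" if "1 \<le> m" for m
  proof (cases "m = 1")
    case False
    with that have "2 \<le> m" by simp
    then obtain i where i: "m = Suc i" "1 \<le> i" by (cases m) auto
    \<comment> \<open>Since \<open>s m\<close> is \<open>\<Phi> m (s i)\<close>, contraction turns
      the error of \<open>s i\<close>, which lies in \<open>F i\<close>, into one in
      \<open>F m\<close>.\<close>
    have "u - \<Phi> m u = (u - s m) - (\<Phi> m u - \<Phi> m (s i))" by (simp add: i s)
    also have "\<dots> \<in> F m"
      using F_diff[OF that u(2)[OF that]] \<Phi>_contract[OF u(2)[OF i(2)] i(2), of m] i(1) by blast
    finally show ?thesis .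
  qed (use F_one in simp)
  then have "\<forall>m\<ge>1. curv Q (z(\<sigma> := u)) m \<tau> \<in> F m" by (simp add: curv_eq F_alt)
  with u(1) show ?thesis unfolding \<sigma>_def d_def by blast
qed

end

section \<open>The Maurer-Cartan equation without Koszul signs\<close>

lemma sum_fun_apply: "(\<Sum>i\<in>I. f i) v = (\<Sum>i\<in>I. f i v)"
  for f :: "'i \<Rightarrow> 'v \<Rightarrow> 'a::comm_monoid_add"
  by (induction I rule: infinite_finite_induct) auto

lemma sublist_in_faces:
  "\<tau> \<in> faces n \<Longrightarrow> take i (drop j \<tau>) \<noteq> [] \<Longrightarrow> take i (drop j \<tau>) \<in> faces n"
  by (auto simp: faces_def sorted_wrt_take sorted_wrt_drop dest!: in_set_takeD in_set_dropD)

lemma omit_in_faces: "\<tau> \<in> faces n \<Longrightarrow> omit g \<tau> \<noteq> [] \<Longrightarrow> omit g \<tau> \<in> faces n"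
proof -
  assume \<tau>: "\<tau> \<in> faces n" and ne: "omit g \<tau> \<noteq> []"
  have "sorted_wrt (<) (take g \<tau> @ drop g \<tau>)" using \<tau> by (simp add: faces_def)
  then have "sorted_wrt (<) (omit g \<tau>)"
    unfolding omit_def sorted_wrt_append
    using sorted_wrt_drop[of "(<)" "drop g \<tau>" 1] set_drop_subset_set_drop[of g "Suc g" \<tau>]
    by (auto simp: drop_drop)
  then show ?thesis using \<tau> ne by (auto simp: faces_def omit_def dest: in_set_takeD in_set_dropD)
qed

lemma splits_in_faces: "\<tau> \<in> faces n \<Longrightarrow> \<rho> \<in> splits l \<tau> \<Longrightarrow> set \<rho> \<subseteq> faces n"
  using splits_piece sublist_in_faces by (metis subsetI)

lemma join_in_faces:
  assumes "\<sigma> \<in> faces n" "\<rho> \<in> faces n" "last \<sigma> = hd \<rho>"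
  shows "\<sigma> @ tl \<rho> \<in> faces n"
proof -
  obtain a \<sigma>' where \<sigma>: "\<sigma> = \<sigma>' @ [a]" using assms(1) by (cases \<sigma> rule: rev_cases) (auto simp: faces_def)
  obtain b \<rho>' where \<rho>: "\<rho> = b # \<rho>'" using assms(2) by (cases \<rho>) (auto simp: faces_def)
  show ?thesis using assms by (auto simp: \<sigma> \<rho> faces_def sorted_wrt_append intro: less_trans)
qed

text \<open>Turns the matching condition of \<open>cup_basis\<close> into a formula for the second
  factor, so that the sum over it collapses to one term.\<close>

lemma join_iff:
  assumes "\<sigma> \<noteq> []" "\<beta> \<noteq> []"
  shows "last \<sigma> = hd \<beta> \<and> \<tau> = \<sigma> @ tl \<beta> \<longleftrightarrow>
    length \<sigma> \<le> length \<tau> \<and> take (length \<sigma>) \<tau> = \<sigma> \<and> \<beta> = drop (length \<sigma> - 1) \<tau>"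
proof -
  obtain a \<sigma>' where \<sigma>: "\<sigma> = \<sigma>' @ [a]" using assms(1) by (cases \<sigma> rule: rev_cases) auto
  obtain b \<beta>' where \<beta>: "\<beta> = b # \<beta>'" using assms(2) by (cases \<beta>) auto
  show ?thesis
  proof
    assume "length \<sigma> \<le> length \<tau> \<and> take (length \<sigma>) \<tau> = \<sigma> \<and> \<beta> = drop (length \<sigma> - 1) \<tau>"
    then have "\<tau> = \<sigma> @ drop (length \<sigma>) \<tau>" "\<beta> = drop (length \<sigma>') \<tau>"
      using append_take_drop_id[of "length \<sigma>" \<tau>] by (simp_all add: \<sigma>)
    then obtain t where "\<tau> = \<sigma>' @ [a] @ t" "\<beta> = drop (length \<sigma>') \<tau>" using \<sigma> by auto
    then show "last \<sigma> = hd \<beta> \<and> \<tau> = \<sigma> @ tl \<beta>" by (simp add: \<sigma>)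
  qed (auto simp: \<sigma> \<beta>)
qed

lemma cup_off_faces:
  assumes "\<tau> \<notin> faces n"
  shows "cup n \<phi> \<psi> \<tau> = 0"
proof -
  have "cup_basis \<sigma> \<rho> \<tau> = (0::'a)" if "\<sigma> \<in> faces n" "\<rho> \<in> faces n" for \<sigma> \<rho>
    using join_in_faces[OF that] assms by (auto simp: cup_basis_def basis_cochain_def)
  then show ?thesis by (simp add: cup_def)
qed

lemma cup_list_basis_off_faces:
  "set \<sigma>s \<subseteq> faces n \<Longrightarrow> \<sigma>s \<noteq> [] \<Longrightarrow> \<tau> \<notin> faces n \<Longrightarrow> cup_list n (map basis_cochain \<sigma>s) \<tau> = 0"
proof (induction \<sigma>s rule: induct_list012)
  case (3 \<sigma> \<sigma>' \<sigma>s)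
  then show ?case by (simp add: cup_off_faces)
qed (auto simp: basis_cochain_def)

lemma Cons_splits_iff:
  assumes "\<sigma> \<noteq> []"
  shows "\<sigma> # \<rho> \<in> splits (Suc l) \<tau> \<longleftrightarrow>
    length \<sigma> \<le> length \<tau> \<and> take (length \<sigma>) \<tau> = \<sigma> \<and> \<rho> \<in> splits l (drop (length \<sigma> - 1) \<tau>)"
proof
  assume "\<sigma> # \<rho> \<in> splits (Suc l) \<tau>"
  then obtain j where j: "j < length \<tau>" "\<sigma> = take (Suc j) \<tau>" "\<rho> \<in> splits l (drop j \<tau>)" by auto
  then have "length \<sigma> = Suc j" by simp
  with j show "length \<sigma> \<le> length \<tau> \<and> take (length \<sigma>) \<tau> = \<sigma> \<and> \<rho> \<in> splits l (drop (length \<sigma> - 1) \<tau>)"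
    by simp
next
  assume *: "length \<sigma> \<le> length \<tau> \<and> take (length \<sigma>) \<tau> = \<sigma> \<and> \<rho> \<in> splits l (drop (length \<sigma> - 1) \<tau>)"
  obtain j where j: "length \<sigma> = Suc j" using assms by (cases \<sigma>) auto
  then have "j \<in> {..<length \<tau>}" "\<sigma> # \<rho> \<in> (#) (take (Suc j) \<tau>) ` splits l (drop j \<tau>)"
    using * by simp_all
  then show "\<sigma> # \<rho> \<in> splits (Suc l) \<tau>" unfolding splits.simps by (rule UN_I)
qed

text \<open>Each factor of a nonzero product starts at the last vertex of the preceding one, which
  is the recursion defining \<open>splits\<close>. Thus sums over tuples of faces become sums over
  splittings.\<close>

lemma cup_list_basis:
  assumes "set \<sigma>s \<subseteq> faces n" "\<sigma>s \<noteq> []" "\<tau> \<in> faces n"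
  shows "cup_list n (map basis_cochain \<sigma>s) \<tau> = (if \<sigma>s \<in> splits (length \<sigma>s) \<tau> then 1 else (0::'k::field))"
  using assms
proof (induction \<sigma>s arbitrary: \<tau> rule: induct_list012)
  case (2 \<sigma>)
  then show ?case using splits_one[of \<tau>]
    by (auto simp: basis_cochain_def faces_def simp del: splits.simps(2))
next
  case (3 \<sigma> \<sigma>' \<sigma>s)
  define B where "B = (cup_list n (map basis_cochain (\<sigma>' # \<sigma>s)) :: 'k cochain)"
  let ?l = "length (\<sigma>' # \<sigma>s)"
  let ?\<beta> = "drop (length \<sigma> - 1) \<tau>"
  have IH: "B \<beta> = (if \<sigma>' # \<sigma>s \<in> splits ?l \<beta> then 1 else 0)" if "\<beta> \<in> faces n" for \<beta>
    unfolding B_def using 3 that by (intro "3.IH"(2)) auto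
  have \<sigma>: "\<sigma> \<in> faces n" "\<sigma> \<noteq> []" using 3 by (auto simp: faces_def)
  let ?P = "length \<sigma> \<le> length \<tau> \<and> take (length \<sigma>) \<tau> = \<sigma>"
  have "cup_list n (map basis_cochain (\<sigma> # \<sigma>' # \<sigma>s)) \<tau> = cup n (basis_cochain \<sigma>) B \<tau>"
    by (simp add: B_def)
  also have "\<dots> = (\<Sum>\<alpha>\<in>faces n. if \<alpha> = \<sigma> then \<Sum>\<beta>\<in>faces n. B \<beta> * cup_basis \<sigma> \<beta> \<tau> else 0)"
    unfolding cup_def by (intro sum.cong refl) (simp add: basis_cochain_def)
  also have "\<dots> = (\<Sum>\<beta>\<in>faces n. B \<beta> * cup_basis \<sigma> \<beta> \<tau>)"
    using \<sigma> by (simp add: finite_faces)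
  also have "\<dots> = (\<Sum>\<beta>\<in>faces n. if \<beta> = ?\<beta> then (if ?P then B ?\<beta> else 0) else 0)"
  proof (intro sum.cong refl)
    fix \<beta> assume "\<beta> \<in> faces n"
    then have "\<beta> \<noteq> []" by (auto simp: faces_def)
    have "cup_basis \<sigma> \<beta> \<tau> = (if last \<sigma> = hd \<beta> \<and> \<tau> = \<sigma> @ tl \<beta> then 1 else (0::'k))"
      by (auto simp: cup_basis_def basis_cochain_def)
    then show "B \<beta> * cup_basis \<sigma> \<beta> \<tau> = (if \<beta> = ?\<beta> then (if ?P then B ?\<beta> else 0) else 0)"
      unfolding join_iff[OF \<sigma>(2) \<open>\<beta> \<noteq> []\<close>] by auto
  qed
  also have "\<dots> = (if ?\<beta> \<in> faces n \<and> ?P then B ?\<beta> else 0)"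
    by (simp add: finite_faces)
  also have "\<dots> = (if \<sigma> # \<sigma>' # \<sigma>s \<in> splits (Suc ?l) \<tau> then 1 else 0)"
  proof (cases ?P)
    case True
    then have "?\<beta> \<noteq> []" using \<sigma>(2) by (cases \<sigma>) auto
    then have "?\<beta> \<in> faces n"
      using sublist_in_faces[OF \<open>\<tau> \<in> faces n\<close>, of "length \<tau>" "length \<sigma> - 1"] by simp
    then show ?thesis using True IH Cons_splits_iff[OF \<sigma>(2), of "\<sigma>' # \<sigma>s" ?l \<tau>] by simp
  qed (auto simp: Cons_splits_iff[OF \<sigma>(2)] simp del: splits.simps)
  finally show ?case by simp
qed simp

definition tri :: "nat \<Rightarrow> nat" where
  "tri n = \<Sum>{..<n}"

lemma tri_Suc: "tri (Suc n) = tri n + n"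
  by (simp add: tri_def)

text \<open>\<open>tri n\<close> is the binomial coefficient n choose 2: among the pairs from
  \<open>a + b\<close> objects, \<open>a * b\<close> are mixed.\<close>

lemma tri_add: "tri (a + b) = tri a + tri b + a * b"
  by (induction b) (simp_all add: tri_Suc, simp add: tri_def)

lemma tri_sum: "tri (\<Sum>j<(k::nat). d j) = (\<Sum>j<k. (\<Sum>i<j. d i) * d j) + (\<Sum>j<k. tri (d j))"
  by (induction k) (simp_all add: tri_add, simp add: tri_def)

text \<open>Shuffling factors of degrees \<open>d j\<close> gives \<open>-1\<close> to the sum of the products \<open>d i * d j\<close> over
  \<open>i < j\<close>. By \<open>tri_sum\<close> this is the deviation of \<open>tri\<close> from additivity, so twisting by \<open>tri\<close> removes
  all Koszul signs from \<open>NQ\<close>.\<close>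

definition twist :: "('v list \<Rightarrow> 'a::ab_group_add) \<Rightarrow> 'v list \<Rightarrow> 'a" where
  "twist x \<sigma> = alt (tri (length \<sigma> - 1)) (x \<sigma>)"

lemma twist_eq_0_iff [simp]: "twist x \<sigma> = 0 \<longleftrightarrow> x \<sigma> = 0"
  by (simp add: twist_def alt_eq_0_iff)

context complete_shifted_Ainf
begin

lemma tensor_grD:
  assumes "x \<in> tensor_gr gr n 0"
  shows "x p \<in> gr (- int (length p - 1))"
  using assms by (cases "p \<in> faces n")
    (auto simp: tensor_gr_def tensor_space_def sdim_def subspace_0[OF gr_subspace])

lemma twist_gr: "x \<in> tensor_gr gr n 0 \<Longrightarrow> twist x p \<in> gr (- int (length p - 1))"
  using tensor_grD by (simp add: twist_def gr_alt)

lemma tensor_space_Nil: "x \<in> tensor_space n \<Longrightarrow> x [] = 0"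
  by (simp add: tensor_space_def faces_def)

lemma tensor_gr_space: "x \<in> tensor_gr gr n d \<Longrightarrow> x \<in> tensor_space n"
  by (simp add: tensor_gr_def)

lemma koszul_alt: "a \<in> gr (- int d) \<Longrightarrow> koszul gr a = alt d a"
  by (simp add: koszul_homogeneous alt_def)

lemma koszul_power: "a \<in> gr (- int d) \<Longrightarrow> (koszul gr ^^ m) a = alt (m * d) a"
  by (induction m) (simp_all add: koszul_alt gr_alt alt_alt)

lemma scale_neg_one_power: "smul ((-1) ^ m) a = alt m a"
  by (cases "even m") (auto simp: alt_def)

text \<open>For \<open>l \<ge> 2\<close> the reordering sign and the signs of the twisted arguments
  combine, by \<open>tri_sum\<close>, into a sign depending only on the dimension of
  \<open>\<tau>\<close>, which leaves the sum over splittings. The same twist also absorbs the sign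
  of the simplicial differential.\<close>

lemma NQ_replicate:
  assumes x: "x \<in> tensor_gr gr n 0" and \<tau>: "\<tau> \<in> faces n"
  shows "NQ smul gr Q n (replicate l x) \<tau> = alt (tri (length \<tau> - 1))
    ((\<Sum>\<rho>\<in>splits l \<tau>. Q (map (twist x) \<rho>)) + (if l = 1 then bd (twist x) \<tau> else 0))"
proof -
  have ne: "\<tau> \<noteq> []" using \<tau> by (auto simp: faces_def)
  have off: "x \<sigma> = 0" if "\<sigma> \<notin> faces n" for \<sigma> using tensor_gr_space[OF x] that by (simp add: tensor_space_def)
  consider "l = 0" | "l = 1" | m where "l = Suc (Suc m)" by (cases l rule: nat.exhaust; cases "l - 1") auto
  then show ?thesis
  proof cases
    case 1
    have "cochain_one n \<tau> = (\<Sum>i\<le>n. if \<tau> = [i] then 1 else (0::'k))"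
      by (simp add: cochain_one_def sum_fun_apply basis_cochain_def)
    also have "\<dots> = (if length \<tau> = 1 then 1 else 0)"
      using \<tau> by (auto simp: length_Suc_conv faces_def)
    finally show ?thesis using 1 by (auto simp: tensor_def tri_def)
  next
    case 2
    have "tensor_map smul n (\<lambda>a. Q [a]) id x \<tau> = (\<Sum>\<sigma>\<in>faces n. if \<sigma> = \<tau> then Q [x \<tau>] else 0)"
      unfolding tensor_map_def sum_fun_apply
      by (intro sum.cong refl) (auto simp: tensor_def basis_cochain_def)
    also have "\<dots> = Q [x \<tau>]" using \<tau> by (simp add: finite_faces)
    finally have Q1: "tensor_map smul n (\<lambda>a. Q [a]) id x \<tau> = Q [x \<tau>]" .
    have "tensor_map smul n (koszul gr) (cochain_d n) x \<tau>
        = (\<Sum>\<sigma>\<in>faces n. \<Sum>k<length \<tau>. if \<sigma> = omit k \<tau> then alt k (koszul gr (x \<sigma>)) else 0)"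
      unfolding tensor_map_def sum_fun_apply tensor_def cochain_d_def scale_sum_left if_P[OF \<tau>]
      by (intro sum.cong refl) (auto simp: basis_cochain_def omit_def[symmetric] scale_neg_one_power)
    also have "\<dots> = (\<Sum>k<length \<tau>. \<Sum>\<sigma>\<in>faces n. if \<sigma> = omit k \<tau> then alt k (koszul gr (x \<sigma>)) else 0)"
      by (rule sum.swap)
    also have "\<dots> = (\<Sum>k<length \<tau>. alt (tri (length \<tau> - 1)) (alt k (twist x (omit k \<tau>))))"
    proof (intro sum.cong refl)
      fix k assume "k \<in> {..<length \<tau>}"
      then have len: "length (omit k \<tau>) = length \<tau> - 1" by (simp add: length_omit)
      show "(\<Sum>\<sigma>\<in>faces n. if \<sigma> = omit k \<tau> then alt k (koszul gr (x \<sigma>)) else 0)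
        = alt (tri (length \<tau> - 1)) (alt k (twist x (omit k \<tau>)))"
      proof (cases "omit k \<tau> \<in> faces n")
        case True
        with len obtain e where e: "length \<tau> = Suc (Suc e)"
          by (cases \<tau>; cases "tl \<tau>") (auto simp: faces_def)
        \<comment> \<open>The value on this face of dimension \<open>e\<close> has degree
          \<open>-e\<close>; its sign is the quotient of the twists in dimensions
          \<open>Suc e\<close> and \<open>e\<close>, as
          \<open>tri (Suc e) = tri e + e\<close>.\<close>
        have "koszul gr (x (omit k \<tau>)) = alt e (x (omit k \<tau>))"
          using tensor_grD[OF x, of "omit k \<tau>"] len e by (simp add: koszul_alt)
        then show ?thesis using True len
          by (cases "even k"; cases "even e"; cases "even (tri e)")
            (simp_all add: finite_faces twist_def e tri_Suc alt_def)
      next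
        case False
        then show ?thesis using off by (simp add: finite_faces twist_def)
      qed
    qed
    finally have d1: "tensor_map smul n (koszul gr) (cochain_d n) x \<tau> = alt (tri (length \<tau> - 1)) (bd (twist x) \<tau>)"
      unfolding bd_def alt_sum .
    have "Q [twist x \<tau>] = alt (tri (length \<tau> - 1)) (Q [x \<tau>])"
      using Q_alt[of "[]" "tri (length \<tau> - 1)" "x \<tau>" "[]"] by (simp add: twist_def)
    then show ?thesis using 2 ne splits_one[of \<tau>]
      by (simp add: Q1 d1 alt_add del: splits.simps(2))
  next
    case 3
    let ?S = "{\<sigma>s. length \<sigma>s = l \<and> set \<sigma>s \<subseteq> faces n}"
    let ?q = "\<lambda>\<sigma>s. Q (map (\<lambda>j. (koszul gr ^^ (\<Sum>i<j. sdim (\<sigma>s ! i))) (x (\<sigma>s ! j))) [0..<l])"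
    have fin: "finite ?S" using finite_lists_length_eq[OF finite_faces[of n], of l]
      by (rule finite_subset[rotated]) auto
    have sub: "splits l \<tau> \<subseteq> ?S" using splits_in_faces[OF \<tau>] length_splits by blast
    have nth: "(x # x # replicate m x) ! j = x" if "j < l" for j
      using that 3 nth_replicate[of j "Suc (Suc m)" x] by simp
    have "NQ smul gr Q n (replicate l x) \<tau> = (\<Sum>\<sigma>s\<in>?S. smul (cup_list n (map basis_cochain \<sigma>s) \<tau>) (?q \<sigma>s))"
    proof -
      have len: "length (x # x # replicate m x) = l" using 3 by simp
      have "map (\<lambda>j. (koszul gr ^^ (\<Sum>i<j. sdim (\<sigma>s ! i))) (((x # x # replicate m x) ! j) (\<sigma>s ! j))) [0..<l]
          = map (\<lambda>j. (koszul gr ^^ (\<Sum>i<j. sdim (\<sigma>s ! i))) (x (\<sigma>s ! j))) [0..<l]" for \<sigma>s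
        by (intro map_cong refl) (simp add: nth)
      then have "NQ smul gr Q n (x # x # replicate m x) \<tau>
          = (\<Sum>\<sigma>s\<in>?S. smul (cup_list n (map basis_cochain \<sigma>s) \<tau>) (?q \<sigma>s))"
        by (simp only: NQ.simps Let_def sum_fun_apply tensor_def len)
      then show ?thesis by (simp only: 3 replicate_Suc)
    qed
    also have "\<dots> = (\<Sum>\<sigma>s\<in>?S. if \<sigma>s \<in> splits l \<tau> then ?q \<sigma>s else 0)"
    proof (intro sum.cong refl)
      fix \<sigma>s assume "\<sigma>s \<in> ?S"
      then have "cup_list n (map basis_cochain \<sigma>s) \<tau> = (if \<sigma>s \<in> splits l \<tau> then 1 else (0::'k))"
        using 3 cup_list_basis[of \<sigma>s n \<tau>] \<tau> by fastforce
      then show "smul (cup_list n (map basis_cochain \<sigma>s) \<tau>) (?q \<sigma>s) = (if \<sigma>s \<in> splits l \<tau> then ?q \<sigma>s else 0)"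
        by (simp del: splits.simps)
    qed
    also have "\<dots> = (\<Sum>\<sigma>s\<in>splits l \<tau>. ?q \<sigma>s)"
      unfolding sum.inter_restrict[OF fin, symmetric] using sub by (simp only: Int_absorb1)
    also have "\<dots> = (\<Sum>\<sigma>s\<in>splits l \<tau>. alt (tri (length \<tau> - 1)) (Q (map (twist x) \<sigma>s)))"
    proof (intro sum.cong refl)
      fix \<sigma>s assume \<sigma>s: "\<sigma>s \<in> splits l \<tau>"
      define d where "d j = length (\<sigma>s ! j) - 1" for j
      have len: "length \<sigma>s = l" using \<sigma>s by (rule length_splits)
      have "(koszul gr ^^ (\<Sum>i<j. sdim (\<sigma>s ! i))) (x (\<sigma>s ! j)) = alt ((\<Sum>i<j. d i) * d j) (x (\<sigma>s ! j))" for j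
        using koszul_power[OF tensor_grD[OF x]] by (simp add: d_def sdim_def)
      then have "?q \<sigma>s = alt (\<Sum>j\<leftarrow>[0..<l]. (\<Sum>i<j. d i) * d j) (Q (map (\<lambda>j. x (\<sigma>s ! j)) [0..<l]))"
        using Q_map_alt[of "[]" _ _ _ "[]"] by simp
      also have "map (\<lambda>j. x (\<sigma>s ! j)) [0..<l] = map x \<sigma>s"
        using len by (intro nth_equalityI) auto
      also have "(\<Sum>j\<leftarrow>[0..<l]. (\<Sum>i<j. d i) * d j) = (\<Sum>j<l. (\<Sum>i<j. d i) * d j)"
        by (simp add: interv_sum_list_conv_sum_set_nat atLeast0LessThan)
      finally have q: "?q \<sigma>s = alt (\<Sum>j<l. (\<Sum>i<j. d i) * d j) (Q (map x \<sigma>s))" .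
      have "(\<Sum>p\<leftarrow>\<sigma>s. tri (length p - 1)) = (\<Sum>j<l. tri (d j))"
        using len by (simp add: sum_list_sum_nth d_def atLeast0LessThan)
      then have tw: "Q (map (twist x) \<sigma>s) = alt (\<Sum>j<l. tri (d j)) (Q (map x \<sigma>s))"
        using Q_map_alt[of "[]" "\<lambda>p. tri (length p - 1)" x \<sigma>s "[]"] by (simp add: twist_def[abs_def])
      have "length \<tau> - 1 = (\<Sum>j<l. d j)"
        using total_dim_splits[OF \<sigma>s] len by (simp add: total_dim_def sum_list_sum_nth d_def atLeast0LessThan)
      then show "?q \<sigma>s = alt (tri (length \<tau> - 1)) (Q (map (twist x) \<sigma>s))"
        unfolding q tw by (simp add: tri_sum alt_alt) (simp add: alt_def)
    qed
    finally show ?thesis using 3 by (simp add: alt_sum)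
  qed
qed

lemma NQ_replicate_off_faces:
  assumes "\<tau> \<notin> faces n"
  shows "NQ smul gr Q n (replicate l x) \<tau> = 0"
proof -
  have [simp]: "cochain_one n \<tau> = (0::'k)"
    using assms by (auto simp: cochain_one_def sum_fun_apply basis_cochain_def faces_def intro!: sum.neutral
        split: if_split_asm)
  consider "l = 0" | "l = 1" | m where "l = Suc (Suc m)" by (cases l rule: nat.exhaust; cases "l - 1") auto
  then show ?thesis
  proof cases
    case 2
    then show ?thesis using assms
      by (auto simp: tensor_map_def sum_fun_apply tensor_def basis_cochain_def cochain_d_def intro!: sum.neutral)
  next
    case 3
    have 0: "(\<Sum>\<sigma>s | length \<sigma>s = Suc (Suc m) \<and> set \<sigma>s \<subseteq> faces n.
        smul (cup_list n (map basis_cochain \<sigma>s) \<tau>) (G \<sigma>s)) = 0" for G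
    proof (intro sum.neutral ballI)
      fix \<sigma>s assume "\<sigma>s \<in> {\<sigma>s. length \<sigma>s = Suc (Suc m) \<and> set \<sigma>s \<subseteq> faces n}"
      then have "cup_list n (map basis_cochain \<sigma>s) \<tau> = (0::'k)"
        using assms by (intro cup_list_basis_off_faces) auto
      then show "smul (cup_list n (map basis_cochain \<sigma>s) \<tau>) (G \<sigma>s) = 0" by simp
    qed
    show ?thesis
      unfolding 3 replicate_Suc NQ.simps Let_def sum_fun_apply tensor_def list.size length_replicate
      using 0 by simp
  qed (simp add: tensor_def)
qed

text \<open>The limit is tested face by face. Terms with at least \<open>m\<close> arguments lie in
  \<open>F m\<close>, so the limit vanishes exactly when each partial sum of order \<open>m\<close>
  is already in \<open>F m\<close>; after this the metric is no longer mentioned.\<close>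

lemma MC_simp_iff:
  "x \<in> MC_simp smul gr Q F n \<longleftrightarrow>
    x \<in> tensor_gr gr n 0 \<and> (\<forall>\<tau>\<in>faces n. \<forall>m\<ge>1. curv Q (twist x) m \<tau> \<in> F m)"
proof (cases "x \<in> tensor_gr gr n 0")
  case x: True
  let ?F = "tensor_F F n"
  define S where "S m = (\<Sum>l<m. NQ smul gr Q n (replicate l x))" for m
  have S_off: "S m \<tau> = 0" if "\<tau> \<notin> faces n" for m \<tau>
    using that by (simp add: S_def sum_fun_apply NQ_replicate_off_faces)
  \<comment> \<open>\<open>curv\<close> always contains the boundary, whereas in \<open>S m\<close>
    it belongs to the term \<open>l = 1\<close>; hence \<open>2 \<le> m\<close>.\<close>
  have S_eq: "S m \<tau> = alt (tri (length \<tau> - 1)) (curv Q (twist x) m \<tau>)" if "2 \<le> m" "\<tau> \<in> faces n" for m \<tau>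
  proof -
    have "S m \<tau> = alt (tri (length \<tau> - 1)) ((\<Sum>l<m. \<Sum>\<rho>\<in>splits l \<tau>. Q (map (twist x) \<rho>))
        + (\<Sum>l<m. if l = 1 then bd (twist x) \<tau> else 0))"
      unfolding S_def sum_fun_apply NQ_replicate[OF x that(2)] alt_sum[symmetric] sum.distrib ..
    also have "(\<Sum>l<m. if l = 1 then bd (twist x) \<tau> else 0) = bd (twist x) \<tau>"
      using that(1) by (subst sum.delta) auto
    finally show ?thesis unfolding curv_def .
  qed
  have curv_gr: "curv Q (twist x) m \<tau> \<in> gr (1 - int (sdim \<tau>))" if \<tau>: "\<tau> \<in> faces n" for m \<tau>
  proof -
    have "bd (twist x) \<tau> \<in> gr (1 - int (sdim \<tau>))"
    proof (cases "2 \<le> length \<tau>")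
      case True
      then show ?thesis unfolding sdim_def by (intro bd_in_gr twist_gr[OF x])
    next
      case False
      then obtain v where "\<tau> = [v]" using \<tau> by (cases \<tau>) (auto simp: faces_def not_le less_Suc_eq)
      then show ?thesis using tensor_space_Nil[OF tensor_gr_space[OF x]]
        by (simp add: bd_Cons twist_def subspace_0[OF gr_subspace])
    qed
    then show ?thesis unfolding curv_def sdim_def
      using Q_splits_in_gr[OF twist_gr[OF x]]
      by (intro subspace_add[OF gr_subspace] subspace_sum[OF gr_subspace])
  qed
  have S_gr: "S m \<in> tensor_gr gr n 1" if "2 \<le> m" for m
    using S_off S_eq[OF that] curv_gr by (simp add: tensor_gr_def tensor_space_def gr_alt)
  have S_F: "S m \<in> ?F i \<longleftrightarrow> (\<forall>\<tau>\<in>faces n. curv Q (twist x) m \<tau> \<in> F i)" if "2 \<le> m" "1 \<le> i" for m i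
    using S_off S_eq[OF that(1)] that(2) by (simp add: tensor_F_def tensor_space_def F_alt)
  have sep: "\<exists>k\<ge>1. v - w \<notin> ?F k" if "v \<noteq> w" for v w
  proof -
    obtain \<tau> where "v \<tau> \<noteq> w \<tau>" using \<open>v \<noteq> w\<close> by auto
    then obtain k where "1 \<le> k" "v \<tau> - w \<tau> \<notin> F k" using ex_not_in_F by blast
    moreover from this have "v \<tau> - w \<tau> \<noteq> 0" using F_0 by auto
    ultimately show ?thesis
      by (intro exI[of _ k]) (auto simp: tensor_F_def tensor_space_def)
  qed
  have F0: "0 \<in> ?F k" and diff: "v \<in> ?F k \<Longrightarrow> w \<in> ?F k \<Longrightarrow> v - w \<in> ?F k" if "1 \<le> k" for k v w
    using that by (auto simp: tensor_F_def tensor_space_def F_0 F_diff)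
  have dec: "?F (Suc k) \<subseteq> ?F k" if "1 \<le> k" for k
    using F_decreasing[OF that] by (auto simp: tensor_F_def)
  have one: "v - w \<in> ?F 1" if "v \<in> tensor_gr gr n 1" "w \<in> tensor_gr gr n 1" for v w
    using that F_one by (auto simp: tensor_F_def tensor_space_def tensor_gr_def)
  have sep0: "(\<Inter>k\<in>{1..}. ?F k) = {0}"
    using sep[of _ 0] F0 by (auto simp del: One_nat_def)
  interpret Metric_space "tensor_gr gr n 1" "filt_dist ?F"
    using dec F0 diff one sep0 by (rule Metric_space_filt_dist)
  have gr0: "0 \<in> tensor_gr gr n 1"
    by (simp add: tensor_gr_def tensor_space_def subspace_0[OF gr_subspace])
  have less: "filt_dist ?F (S m) 0 < 1 / 2 ^ i \<longleftrightarrow> (\<forall>\<tau>\<in>faces n. curv Q (twist x) m \<tau> \<in> F (Suc i))" if "2 \<le> m" for m i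
    using filt_dist_less_iff[of ?F "S m" 0 i, OF dec one[OF S_gr[OF that] gr0] sep F0] S_F[OF that, of "Suc i"]
    by simp
  have "limitin mtopology S 0 sequentially \<longleftrightarrow> (\<forall>\<tau>\<in>faces n. \<forall>m\<ge>1. curv Q (twist x) m \<tau> \<in> F m)"
  proof (intro iffI ballI allI impI)
    fix \<tau> and m :: nat assume lim: "limitin mtopology S 0 sequentially" and \<tau>: "\<tau> \<in> faces n" and m: "1 \<le> m"
    obtain N where N: "\<And>i. N \<le> i \<Longrightarrow> filt_dist ?F (S i) 0 < 1 / 2 ^ (m - 1)"
      using lim unfolding limit_metric_sequentially
      by (metis zero_less_divide_1_iff zero_less_numeral zero_less_power)
    \<comment> \<open>Orders beyond \<open>m\<close> change the sum only within \<open>F m\<close>,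
      so information about late partial sums descends to order \<open>m\<close>.\<close>
    have "curv Q (twist x) (m + j) \<tau> - curv Q (twist x) m \<tau> \<in> F m" for j
    proof (induction j)
      case (Suc j)
      have "(\<Sum>\<rho>\<in>splits (m + j) \<tau>. Q (map (twist x) \<rho>)) \<in> F m"
        using m by (intro Q_splits_in_F) auto
      from F_add[OF m Suc this] show ?case by (simp add: curv_Suc algebra_simps)
    qed (use F_0[OF m] in simp)
    moreover have "curv Q (twist x) (m + (N + 2)) \<tau> \<in> F m"
      using less[of "m + (N + 2)" "m - 1"] N[of "m + (N + 2)"] m \<tau> by simp
    ultimately have "curv Q (twist x) (m + (N + 2)) \<tau> -
        (curv Q (twist x) (m + (N + 2)) \<tau> - curv Q (twist x) m \<tau>) \<in> F m"
      using F_diff[OF m] by blast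
    then show "curv Q (twist x) m \<tau> \<in> F m" by simp
  next
    assume *: "\<forall>\<tau>\<in>faces n. \<forall>m\<ge>1. curv Q (twist x) m \<tau> \<in> F m"
    show "limitin mtopology S 0 sequentially" unfolding limit_metric_sequentially
    proof (intro conjI allI impI gr0)
      fix e :: real assume "0 < e"
      then obtain i where i: "1 / 2 ^ i < e"
        using real_arch_pow_inv[of e "1/2"] by (auto simp: power_divide)
      have "S m \<in> tensor_gr gr n 1 \<and> filt_dist ?F (S m) 0 < e" if m: "i + 2 \<le> m" for m
      proof
        show "S m \<in> tensor_gr gr n 1" using m by (intro S_gr) simp
        have "F m \<subseteq> F (Suc i)" by (rule F_mono) (use m in auto)
        then have "filt_dist ?F (S m) 0 < 1 / 2 ^ i" using * less[of m i] m by auto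
        then show "filt_dist ?F (S m) 0 < e" using i by simp
      qed
      then show "\<exists>N. \<forall>m\<ge>N. S m \<in> tensor_gr gr n 1 \<and> filt_dist ?F (S m) 0 < e" by blast
    qed
  qed
  then show ?thesis using x by (simp add: MC_simp_def MC_def S_def[abs_def])
qed (simp add: MC_simp_def MC_def)

end

section \<open>Pullbacks and horn fillers\<close>

definition pull :: "nat \<Rightarrow> (nat \<Rightarrow> nat) \<Rightarrow> (nat list \<Rightarrow> 'a::zero) \<Rightarrow> nat list \<Rightarrow> 'a" where
  "pull m \<theta> x = (\<lambda>\<tau>. if \<tau> \<in> faces m then x (map \<theta> \<tau>) else 0)"

lemma pull_in_tensor_space: "pull m \<theta> x \<in> tensor_space m"
  by (simp add: pull_def tensor_space_def)

lemma (in vector_space) tensor_map_pullback: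
  assumes "x \<in> tensor_space n"
  shows "tensor_map scale n id (pullback m \<theta>) x = pull m \<theta> x"
proof
  fix \<tau>
  have "tensor_map scale n id (pullback m \<theta>) x \<tau>
      = (\<Sum>\<sigma>\<in>faces n. if \<sigma> = map \<theta> \<tau> then (if \<tau> \<in> faces m then x (map \<theta> \<tau>) else 0) else 0)"
    unfolding tensor_map_def sum_fun_apply
    by (intro sum.cong refl) (auto simp: tensor_def pullback_def basis_cochain_def)
  also have "\<dots> = pull m \<theta> x \<tau>"
    using assms by (simp add: finite_faces pull_def tensor_space_def)
  finally show "tensor_map scale n id (pullback m \<theta>) x \<tau> = pull m \<theta> x \<tau>" .
qed

lemma pull_cong:
  assumes "\<And>v. v \<le> m \<Longrightarrow> \<theta> v = \<theta>' v"
  shows "pull m \<theta> x = pull m \<theta>' x"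
proof -
  have "map \<theta> \<tau> = map \<theta>' \<tau>" if "\<tau> \<in> faces m" for \<tau>
    using that assms by (auto simp: faces_def)
  then show ?thesis unfolding pull_def by (intro ext if_cong refl arg_cong[of _ _ x])
qed

lemma pull_id: "x \<in> tensor_space m \<Longrightarrow> (\<And>v. v \<le> m \<Longrightarrow> \<theta> v = v) \<Longrightarrow> pull m \<theta> x = x"
  using pull_cong[of m \<theta> id x] by (auto simp: pull_def tensor_space_def)

lemma faces_iff: "\<tau> \<in> faces n \<longleftrightarrow> \<tau> \<noteq> [] \<and> sorted \<tau> \<and> distinct \<tau> \<and> set \<tau> \<subseteq> {..n}"
  by (auto simp: faces_def strict_sorted_iff)

lemma sorted_map_faces:
  assumes "\<tau> \<in> faces m" "mono_on {..m} \<theta>"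
  shows "sorted (map \<theta> \<tau>)"
proof -
  have "sorted \<tau>" "set \<tau> \<subseteq> {..m}" using assms(1) by (auto simp: faces_iff)
  then show ?thesis
    using assms(2) by (simp add: sorted_wrt_map) (rule sorted_wrt_mono_rel, rule mono_onD[OF assms(2)], auto)
qed

text \<open>A monotone image in range fails to be a face only by repeating a vertex. The repetition
  survives the second map, so both sides vanish there.\<close>

lemma pull_pull:
  assumes x: "x \<in> tensor_space n" and \<theta>: "mono_on {..m} \<theta>" "\<theta> ` {..m} \<subseteq> {..m'}"
  shows "pull m \<theta> (pull m' \<theta>' x) = pull m (\<lambda>v. \<theta>' (\<theta> v)) x"
proof
  fix \<tau>
  show "pull m \<theta> (pull m' \<theta>' x) \<tau> = pull m (\<lambda>v. \<theta>' (\<theta> v)) x \<tau>"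
  proof (cases "\<tau> \<in> faces m \<and> map \<theta> \<tau> \<notin> faces m'")
    case True
    then have "\<not> distinct (map \<theta> \<tau>)"
      using \<theta> sorted_map_faces[of \<tau> m \<theta>] by (auto simp: faces_iff)
    then have "map (\<lambda>v. \<theta>' (\<theta> v)) \<tau> \<notin> faces n"
      by (auto simp: faces_iff distinct_map inj_on_def)
    then show ?thesis using True x by (simp add: pull_def tensor_space_def)
  qed (auto simp: pull_def comp_def)
qed

section \<open>Curvature under relabelling and on degenerate lists\<close>

lemma sum_splits_map:
  "(\<Sum>\<rho>\<in>splits l (map \<theta> \<tau>). G \<rho>) = (\<Sum>\<rho>\<in>splits l \<tau>. G (map (map \<theta>) \<rho>))"
  by (induction l arbitrary: \<tau> G)
    (simp, simp only: sum_splits_Suc length_map drop_map take_map list.map)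

lemma omit_map: "omit g (map \<theta> \<tau>) = map \<theta> (omit g \<tau>)"
  by (simp add: omit_def take_map drop_map)

text \<open>Splittings and omissions act on positions, not on vertices, so any relabelling is
  allowed, even one that creates repeated vertices.\<close>

lemma curv_map: "curv Q y m (map \<theta> \<tau>) = curv Q (\<lambda>\<sigma>. y (map \<theta> \<sigma>)) m \<tau>"
  by (simp add: curv_def sum_splits_map bd_def omit_map comp_def)

lemma curv_cong:
  assumes "\<tau> \<in> faces n" "y [] = y' []" "\<And>\<sigma>. \<sigma> \<in> faces n \<Longrightarrow> y \<sigma> = y' \<sigma>"
  shows "curv Q y m \<tau> = curv Q y' m \<tau>"
proof -
  have "map y \<rho> = map y' \<rho>" if "\<rho> \<in> splits l \<tau>" for l \<rho>
    using splits_in_faces[OF assms(1) that] assms(3) by auto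
  moreover have "y (omit g \<tau>) = y' (omit g \<tau>)" for g
    using omit_in_faces[OF assms(1), of g] assms(2,3) by (cases "omit g \<tau> = []") auto
  ultimately show ?thesis unfolding curv_def bd_def
    by (intro arg_cong2[of _ _ _ _ "(+)"] sum.cong refl arg_cong[of _ _ Q] arg_cong[of _ _ "alt _"])
qed

text \<open>Omitting either of the two equal neighbours gives the same list with opposite signs;
  every other omission keeps the repetition.\<close>

lemma bd_degenerate:
  "(\<And>\<sigma>. \<not> distinct \<sigma> \<Longrightarrow> f \<sigma> = 0) \<Longrightarrow> bd f (u @ v # v # w) = 0"
proof (induction u arbitrary: f)
  case Nil
  have "bd (\<lambda>\<sigma>. f (v # v # \<sigma>)) w = 0" by (simp add: bd_def Nil)
  then show ?case by (simp add: bd_Cons)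
next
  case (Cons a u)
  then have "f (u @ v # v # w) = 0" "bd (\<lambda>\<sigma>. f (a # \<sigma>)) (u @ v # v # w) = 0" by auto
  then show ?case by (simp add: bd_Cons)
qed

lemma sorted_not_distinct:
  fixes \<tau> :: "'v::linorder list"
  assumes "sorted \<tau>" "\<not> distinct \<tau>"
  obtains u v w where "\<tau> = u @ v # v # w"
proof -
  have "\<exists>u v w. \<tau> = u @ v # v # w"
    using assms
  proof (induction \<tau>)
    case (Cons a \<tau>)
    show ?case
    proof (cases "distinct \<tau>")
      case True
      then have "a \<in> set \<tau>" using Cons.prems by simp
      then obtain b \<tau>' where \<tau>: "\<tau> = b # \<tau>'" by (cases \<tau>) auto
      have "a = b" using \<open>a \<in> set \<tau>\<close> Cons.prems(1) by (auto simp: \<tau>)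
      then show ?thesis using \<tau> by (intro exI[of _ "[]"]) simp
    next
      case False
      then show ?thesis using Cons by (metis append_Cons sorted_simps(2))
    qed
  qed simp
  then show ?thesis using that by blast
qed

text \<open>Consecutive pieces overlap in a vertex, so two neighbouring positions always lie in a
  common piece.\<close>

lemma splits_degenerate:
  "\<rho> \<in> splits l \<tau> \<Longrightarrow> \<tau> = u @ v # v # w \<Longrightarrow> \<exists>p\<in>set \<rho>. \<not> distinct p"
proof (induction l arbitrary: \<rho> \<tau> u)
  case (Suc l)
  then obtain j \<rho>' where j: "j < length \<tau>" "\<rho>' \<in> splits l (drop j \<tau>)" "\<rho> = take (Suc j) \<tau> # \<rho>'"
    by auto
  show ?case
  proof (cases "j \<le> length u")
    case True
    then have "drop j \<tau> = drop j u @ v # v # w" using Suc.prems(2) by simp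
    with Suc.IH[OF j(2)] j(3) show ?thesis by auto
  next
    case False
    then obtain i where i: "j = length u + Suc i" by (metis add_Suc_right less_imp_Suc_add not_le)
    have "take (Suc j) \<tau> = u @ v # v # take i w" unfolding Suc.prems(2) i by simp
    then show ?thesis using j(3) by simp
  qed
qed (auto split: if_splits)

section \<open>Cofaces, codegeneracies and the faces outside a horn\<close>

lemma coface_mono: "mono_on A (coface i)"
  by (auto simp: coface_def mono_on_def)

lemma codegeneracy_mono: "mono_on A (codegeneracy i)"
  by (auto simp: codegeneracy_def mono_on_def)

lemma coface_range: "i \<le> Suc n \<Longrightarrow> coface i ` {..n} \<subseteq> {..Suc n}"
  by (auto simp: coface_def)

lemma codegeneracy_range: "i \<le> n \<Longrightarrow> codegeneracy i ` {..Suc n} \<subseteq> {..n}"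
  by (auto simp: codegeneracy_def)

lemma coface_ne: "coface i v \<noteq> i"
  by (simp add: coface_def)

lemma codegeneracy_coface: "codegeneracy i (coface i v) = v"
  by (simp add: coface_def codegeneracy_def)

lemma coface_codegeneracy: "v \<noteq> i \<Longrightarrow> coface i (codegeneracy i v) = v"
  by (auto simp: coface_def codegeneracy_def)

lemma map_coface_in_faces:
  assumes "\<tau> \<in> faces n" "i \<le> Suc n"
  shows "map (coface i) \<tau> \<in> faces (Suc n)" "i \<notin> set (map (coface i) \<tau>)"
proof -
  have "inj (coface i)" using codegeneracy_coface by (metis injI)
  then have "distinct (map (coface i) \<tau>)" using assms(1) by (auto simp: faces_iff distinct_map intro: inj_on_subset)
  moreover have "sorted (map (coface i) \<tau>)" by (rule sorted_map_faces[OF assms(1) coface_mono])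
  moreover have "set (map (coface i) \<tau>) \<subseteq> {..Suc n}"
    using assms coface_range[OF assms(2)] by (auto simp: faces_iff)
  ultimately show "map (coface i) \<tau> \<in> faces (Suc n)" using assms(1) by (simp add: faces_iff)
qed (auto simp: coface_ne[symmetric])

text \<open>Away from the vertex \<open>i\<close>, \<open>codegeneracy i\<close> inverts
  \<open>coface i\<close>. This renumbers a face lying in the side opposite \<open>i\<close>, and
  here \<open>i = Suc n\<close> is allowed as well.\<close>

lemma map_codegeneracy_in_faces:
  assumes "\<sigma> \<in> faces (Suc n)" "i \<le> Suc n" "i \<notin> set \<sigma>"
  shows "map (codegeneracy i) \<sigma> \<in> faces n" "map (coface i) (map (codegeneracy i) \<sigma>) = \<sigma>"
proof -
  show eq: "map (coface i) (map (codegeneracy i) \<sigma>) = \<sigma>"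
    using assms(3) by (auto intro!: map_idI coface_codegeneracy)
  have "distinct (map (coface i) (map (codegeneracy i) \<sigma>))"
    unfolding eq using assms(1) by (simp add: faces_iff)
  then have "distinct (map (codegeneracy i) \<sigma>)" by (auto simp: distinct_map intro: inj_on_imageI2)
  moreover have "sorted (map (codegeneracy i) \<sigma>)"
    by (rule sorted_map_faces[OF assms(1) codegeneracy_mono])
  moreover have "codegeneracy i v \<le> n" if "v \<in> set \<sigma>" for v
  proof -
    have "v \<le> Suc n" "v \<noteq> i" using that assms by (auto simp: faces_iff)
    then show ?thesis using assms(2) by (auto simp: codegeneracy_def)
  qed
  ultimately show "map (codegeneracy i) \<sigma> \<in> faces n"
    using assms(1) by (auto simp: faces_iff)
qed

text \<open>A face in no side of the horn contains every vertex other than \<open>k\<close>; whether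
  it also contains \<open>k\<close> leaves two sorted lists.\<close>

lemma face_cases:
  assumes "\<sigma> \<in> faces (Suc n)" "k \<le> Suc n"
  shows "\<sigma> = [0..<Suc (Suc n)] \<or> \<sigma> = omit k [0..<Suc (Suc n)] \<or> (\<exists>i\<le>Suc n. i \<noteq> k \<and> i \<notin> set \<sigma>)"
proof (rule ccontr)
  assume *: "\<not> ?thesis"
  have om: "omit k [0..<Suc (Suc n)] = [0..<k] @ [Suc k..<Suc (Suc n)]"
    using assms(2) by (simp add: omit_def take_upt drop_upt del: upt_Suc)
  have \<sigma>: "sorted \<sigma>" "distinct \<sigma>" "set \<sigma> \<subseteq> {..Suc n}" using assms(1) by (auto simp: faces_iff)
  show False
  proof (cases "k \<in> set \<sigma>")
    case True
    then have "i \<in> set \<sigma>" if "i \<le> Suc n" for i using * that by blast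
    then have "set \<sigma> = set [0..<Suc (Suc n)]" using \<sigma>(3) by (auto simp del: upt_Suc)
    then have "\<sigma> = [0..<Suc (Suc n)]"
      using \<sigma> by (intro sorted_distinct_set_unique) (auto simp del: upt_Suc)
    with * show False by blast
  next
    case False
    have "i \<in> set \<sigma>" if "i \<le> Suc n" "i \<noteq> k" for i using * that by blast
    then have "set \<sigma> = {..Suc n} - {k}" using False \<sigma>(3) by auto
    also have "\<dots> = set (omit k [0..<Suc (Suc n)])"
      unfolding om using assms(2) by (auto simp del: upt_Suc)
    finally have "set \<sigma> = set (omit k [0..<Suc (Suc n)])" .
    then have "\<sigma> = omit k [0..<Suc (Suc n)]"
      unfolding om using \<sigma> by (intro sorted_distinct_set_unique) (auto simp: sorted_append simp del: upt_Suc)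
    with * show False by blast
  qed
qed

section \<open>The simplicial structure on Maurer-Cartan elements\<close>

context complete_shifted_Ainf
begin

lemma curv_pull:
  assumes "x \<in> tensor_space n" "\<tau> \<in> faces m"
  shows "curv Q (twist (pull m \<theta> x)) r \<tau> = curv Q (twist x) r (map \<theta> \<tau>)"
  unfolding curv_map
  using assms tensor_space_Nil[OF assms(1)] tensor_space_Nil[OF pull_in_tensor_space[of m \<theta> x]]
  by (intro curv_cong[of _ m]) (auto simp: twist_def pull_def)

lemma curv_degenerate:
  assumes x: "x \<in> tensor_space n" and \<tau>: "sorted \<tau>" "\<not> distinct \<tau>"
  shows "curv Q (twist x) m \<tau> = 0"
proof -
  obtain u v w where \<tau>_eq: "\<tau> = u @ v # v # w" using sorted_not_distinct[OF \<tau>] .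
  have x0: "twist x \<sigma> = 0" if "\<not> distinct \<sigma>" for \<sigma>
    using that x by (simp add: tensor_space_def faces_iff)
  have "Q (map (twist x) \<rho>) = 0" if "\<rho> \<in> splits l \<tau>" for \<rho> l
    using splits_degenerate[OF that \<tau>_eq] x0 by (intro Q_eq_0) force
  moreover have "bd (twist x) \<tau> = 0" unfolding \<tau>_eq using x0 by (rule bd_degenerate)
  ultimately show ?thesis by (simp add: curv_def)
qed

lemma pull_in_MC_simp:
  assumes x: "x \<in> MC_simp smul gr Q F n" and \<theta>: "mono_on {..m} \<theta>" "\<theta> ` {..m} \<subseteq> {..n}"
  shows "pull m \<theta> x \<in> MC_simp smul gr Q F m"
  unfolding MC_simp_iff
proof (intro conjI ballI allI impI)
  have xg: "x \<in> tensor_gr gr n 0" using x by (simp add: MC_simp_iff)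
  then have xs: "x \<in> tensor_space n" by (rule tensor_gr_space)
  have "x (map \<theta> \<tau>) \<in> gr (- int (sdim \<tau>))" for \<tau>
    using tensor_grD[OF xg, of "map \<theta> \<tau>"] by (simp add: sdim_def)
  then show "pull m \<theta> x \<in> tensor_gr gr m 0"
    using pull_in_tensor_space by (auto simp: tensor_gr_def pull_def)
  fix \<tau> and r :: nat assume \<tau>: "\<tau> \<in> faces m" and r: "1 \<le> r"
  show "curv Q (twist (pull m \<theta> x)) r \<tau> \<in> F r"
  proof (cases "distinct (map \<theta> \<tau>)")
    case True
    then have "map \<theta> \<tau> \<in> faces n"
      using sorted_map_faces[OF \<tau> \<theta>(1)] \<theta>(2) \<tau> by (auto simp: faces_iff)
    then show ?thesis using x r by (simp add: curv_pull[OF xs \<tau>] MC_simp_iff)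
  next
    case False
    then show ?thesis
      using curv_degenerate[OF xs sorted_map_faces[OF \<tau> \<theta>(1)]] F_0[OF r] by (simp add: curv_pull[OF xs \<tau>])
  qed
qed

lemma MC_simp_space: "x \<in> MC_simp smul gr Q F n \<Longrightarrow> x \<in> tensor_space n"
  using tensor_gr_space by (auto simp: MC_simp_iff)

lemma MC_face_eq: "x \<in> tensor_space (Suc n) \<Longrightarrow> MC_face smul n i x = pull n (coface i) x"
  unfolding MC_face_def by (rule tensor_map_pullback)

lemma MC_degen_eq: "x \<in> tensor_space n \<Longrightarrow> MC_degen smul n i x = pull (Suc n) (codegeneracy i) x"
  unfolding MC_degen_def by (rule tensor_map_pullback)

text \<open>By \<open>pull_pull\<close> the simplicial identities reduce to identities between
  composites of cofaces and codegeneracies, needed only on the vertices present.\<close>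

lemma simplicial_set_MC: "simplicial_set (MC_simp smul gr Q F) (MC_face smul) (MC_degen smul)"
proof
  let ?X = "MC_simp smul gr Q F"
  note eqs = MC_face_eq MC_degen_eq MC_simp_space pull_in_tensor_space
  note pp = pull_pull[OF MC_simp_space coface_mono coface_range]
    pull_pull[OF MC_simp_space codegeneracy_mono codegeneracy_range]
  show "MC_face smul n i x \<in> ?X n" if "x \<in> ?X (Suc n)" "i \<le> Suc n" for x n i
    using that pull_in_MC_simp[OF that(1) coface_mono coface_range] by (simp add: eqs)
  show "MC_degen smul n i x \<in> ?X (Suc n)" if "x \<in> ?X n" "i \<le> n" for x n i
    using that pull_in_MC_simp[OF that(1) codegeneracy_mono codegeneracy_range] by (simp add: eqs)
  show "MC_face smul n i (MC_face smul (Suc n) j x) = MC_face smul n (j - 1) (MC_face smul (Suc n) i x)"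
    if "x \<in> ?X (Suc (Suc n))" "i < j" "j \<le> Suc (Suc n)" for x n i j
    using that by (simp add: eqs pp) (rule pull_cong, auto simp: coface_def)
  show "MC_face smul (Suc n) i (MC_degen smul (Suc n) j x) = MC_degen smul n (j - 1) (MC_face smul n i x)"
    if "x \<in> ?X (Suc n)" "i < j" "j \<le> Suc n" for x n i j
    using that by (simp add: eqs pp) (rule pull_cong, auto simp: coface_def codegeneracy_def)
  show "MC_face smul n i (MC_degen smul n j x) = x"
    if "x \<in> ?X n" "j \<le> n" "i = j \<or> i = Suc j" for x n i j
  proof -
    have "i \<le> Suc n" using that by auto
    then show ?thesis
      using that by (simp add: eqs pp) (rule pull_id, auto simp: eqs coface_def codegeneracy_def)
  qed
  show "MC_face smul (Suc n) i (MC_degen smul (Suc n) j x) = MC_degen smul n j (MC_face smul n (i - 1) x)"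
    if "x \<in> ?X (Suc n)" "Suc j < i" "i \<le> Suc (Suc n)" for x n i j
    using that by (simp add: eqs pp) (rule pull_cong, auto simp: coface_def codegeneracy_def)
  show "MC_degen smul (Suc n) i (MC_degen smul n j x) = MC_degen smul (Suc n) (Suc j) (MC_degen smul n i x)"
    if "x \<in> ?X n" "i \<le> j" "j \<le> n" for x n i j
    using that by (simp add: eqs pp) (rule pull_cong, auto simp: codegeneracy_def)
qed

section \<open>Assembly of a filler from the sides of a horn\<close>

lemma horn_filler_MC:
  fixes n k y
  assumes k: "k \<le> Suc n"
    and y: "\<And>i. i \<le> Suc n \<Longrightarrow> i \<noteq> k \<Longrightarrow> y i \<in> MC_simp smul gr Q F n"
    and compat: "\<And>i j. i < j \<Longrightarrow> j \<le> Suc n \<Longrightarrow> i \<noteq> k \<Longrightarrow> j \<noteq> k \<Longrightarrow>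
      MC_face smul (n - 1) i (y j) = MC_face smul (n - 1) (j - 1) (y i)"
  shows "\<exists>x\<in>MC_simp smul gr Q F (Suc n). \<forall>i\<le>Suc n. i \<noteq> k \<longrightarrow> MC_face smul n i x = y i"
proof -
  let ?T = "[0..<Suc (Suc n)]"
  let ?\<sigma> = "omit k ?T"
  let ?in = "\<lambda>\<sigma> i. i \<le> Suc n \<and> i \<noteq> k \<and> i \<notin> set \<sigma>"
  have lenT: "length ?T = Suc (Suc n)" by simp
  have T: "?T \<in> faces (Suc n)" by (auto simp: faces_iff simp del: upt_Suc)
  have len\<sigma>: "length ?\<sigma> = Suc n" using k by (subst length_omit) auto
  have \<sigma>: "?\<sigma> \<in> faces (Suc n)" using omit_in_faces[OF T, of k] len\<sigma> by fastforce
  have set\<sigma>: "i \<in> set ?\<sigma>" if "i \<le> Suc n" "i \<noteq> k" for i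
    using that k by (auto simp: omit_def take_upt drop_upt simp del: upt_Suc)
  have not_in: "\<not> ?in ?T i" for i by (auto simp del: upt_Suc)
  note y_gr = tensor_grD[of "y _", OF conjunct1[OF y[unfolded MC_simp_iff]]]
  have y_space: "y i \<in> tensor_space n" if "i \<le> Suc n" "i \<noteq> k" for i
    using y[OF that] by (rule MC_simp_space)

  \<comment> \<open>A face avoiding both \<open>i\<close> and \<open>j\<close> lies in a common face
    of codimension two, where the compatibility of the horn equates the two values;
    \<open>\<tau>\<close> is this face renumbered. For \<open>n = 0\<close> there are no two such
    indices.\<close>
  have agree: "y i (map (codegeneracy i) \<sigma>) = y j (map (codegeneracy j) \<sigma>)"
    if \<sigma>: "\<sigma> \<in> faces (Suc n)" and ij: "?in \<sigma> i" "?in \<sigma> j" "i < j" for \<sigma> i j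
  proof (cases n)
    case 0
    then show ?thesis using ij k by auto
  next
    case (Suc m)
    define \<tau> where "\<tau> = map (codegeneracy i) (map (codegeneracy j) \<sigma>)"
    have c: "map (codegeneracy j) \<sigma> \<in> faces n" using map_codegeneracy_in_faces[OF \<sigma>] ij by blast
    have "i \<notin> set (map (codegeneracy j) \<sigma>)" using ij by (auto simp: codegeneracy_def split: if_splits)
    from map_codegeneracy_in_faces[OF c[unfolded Suc] _ this]
    have \<tau>: "\<tau> \<in> faces m" "map (coface i) \<tau> = map (codegeneracy j) \<sigma>"
      unfolding \<tau>_def using ij Suc by auto
    have "coface (j - 1) (codegeneracy i (codegeneracy j v)) = codegeneracy i v" if "v \<in> set \<sigma>" for v
    proof -
      have "v \<noteq> i" "v \<noteq> j" using that ij by auto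
      then show ?thesis using ij by (auto simp: coface_def codegeneracy_def)
    qed
    then have "map (coface (j - 1)) \<tau> = map (codegeneracy i) \<sigma>" unfolding \<tau>_def by auto
    moreover have "pull m (coface i) (y j) \<tau> = pull m (coface (j - 1)) (y i) \<tau>"
      using compat[of i j] ij y_space[of i] y_space[of j] by (simp add: Suc MC_face_eq)
    ultimately show ?thesis using \<tau> by (simp add: pull_def)
  qed

  \<comment> \<open>A face may lie in several sides of the horn; by \<open>agree\<close> the choice
    of one is immaterial.\<close>
  define z where "z \<sigma> = (if \<sigma> \<in> faces (Suc n) \<and> (\<exists>i. ?in \<sigma> i)
    then y (SOME i. ?in \<sigma> i) (map (codegeneracy (SOME i. ?in \<sigma> i)) \<sigma>) else 0)" for \<sigma>
  have z_eq: "z \<sigma> = y i (map (codegeneracy i) \<sigma>)" if "\<sigma> \<in> faces (Suc n)" "?in \<sigma> i" for \<sigma> i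
  proof -
    define j where "j = (SOME i. ?in \<sigma> i)"
    have j: "?in \<sigma> j" unfolding j_def using that(2) by (rule someI)
    have "\<exists>i. ?in \<sigma> i" using that(2) by (rule exI)
    then have "z \<sigma> = y j (map (codegeneracy j) \<sigma>)"
      unfolding z_def j_def[symmetric] by (intro if_P conjI that(1))
    also have "\<dots> = y i (map (codegeneracy i) \<sigma>)"
    proof (cases i j rule: linorder_cases)
      case less
      then show ?thesis by (rule agree[OF that j, symmetric])
    next
      case greater
      then show ?thesis by (rule agree[OF that(1) j that(2)])
    qed simp
    finally show ?thesis .
  qed
  have z_gr: "z p \<in> gr (- int (length p - 1))" for p
  proof (cases "p \<in> faces (Suc n) \<and> (\<exists>i. ?in p i)")
    case True
    then obtain i where i: "p \<in> faces (Suc n)" "?in p i" by blast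
    then show ?thesis using y_gr[of i "map (codegeneracy i) p"] by (simp add: z_eq[OF i])
  qed (auto simp: z_def subspace_0[OF gr_subspace])
  have z_off: "z p = 0" if "p \<notin> faces (Suc n)" for p using that by (simp add: z_def)
  have zT: "z ?T = 0" using not_in unfolding z_def by (intro if_not_P) blast

  have "\<exists>u\<in>gr (- int (length ?\<sigma> - 1)). \<forall>m\<ge>1. curv Q ((twist z)(?\<sigma> := u)) m ?T \<in> F m"
    using z_gr zT k lenT by (intro ex_curv_filler) (auto simp: twist_def gr_alt simp del: upt_Suc)
  then obtain u where u: "u \<in> gr (- int (length ?\<sigma> - 1))"
    and curvT: "\<And>m. 1 \<le> m \<Longrightarrow> curv Q ((twist z)(?\<sigma> := u)) m ?T \<in> F m" by blast
  \<comment> \<open>The solution \<open>u\<close> belongs to the sign-free equation, so the twist,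
    an involution, is undone on this face.\<close>
  define x where "x = z(?\<sigma> := alt (tri (length ?\<sigma> - 1)) u)"
  have twist_x: "twist x = (twist z)(?\<sigma> := u)" by (auto simp: x_def twist_def)
  have x_gr: "x \<in> tensor_gr gr (Suc n) 0"
    using z_gr u \<sigma> unfolding tensor_gr_def tensor_space_def sdim_def x_def
    by (auto simp: gr_alt z_off simp del: upt_Suc)
  then have x_space: "x \<in> tensor_space (Suc n)" by (rule tensor_gr_space)
  have face: "pull n (coface i) x = y i" if i: "i \<le> Suc n" "i \<noteq> k" for i
  proof
    fix \<tau>
    show "pull n (coface i) x \<tau> = y i \<tau>"
    proof (cases "\<tau> \<in> faces n")
      case True
      note f = map_coface_in_faces[OF True i(1)]
      \<comment> \<open>The missing face contains every vertex other than \<open>k\<close>, in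
        particular \<open>i\<close>, so the side opposite \<open>i\<close> never sees the new
        value.\<close>
      then have "map (coface i) \<tau> \<noteq> ?\<sigma>" using set\<sigma>[OF i] by metis
      then have "x (map (coface i) \<tau>) = y i (map (codegeneracy i) (map (coface i) \<tau>))"
        using z_eq[OF f(1)] f(2) i by (simp add: x_def)
      then show ?thesis using True by (simp add: pull_def codegeneracy_coface comp_def)
    next
      case False
      then show ?thesis using y_space[OF i] by (simp add: pull_def tensor_space_def)
    qed
  qed
  have curv_other: "curv Q (twist x) m \<sigma> \<in> F m"
    if \<sigma>: "\<sigma> \<in> faces (Suc n)" "\<sigma> \<noteq> ?\<sigma>" and m: "1 \<le> m" for \<sigma> m
  proof (cases "\<sigma> = ?T")
    case True
    then show ?thesis using curvT[OF m] by (simp only: twist_x)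
  next
    case False
    then obtain i where i: "i \<le> Suc n" "i \<noteq> k" "i \<notin> set \<sigma>"
      using face_cases[OF \<sigma>(1) k] \<sigma>(2) by blast
    note f = map_codegeneracy_in_faces[OF \<sigma>(1) i(1,3)]
    have "curv Q (twist (y i)) m (map (codegeneracy i) \<sigma>) \<in> F m"
      using y[OF i(1,2)] f(1) m by (simp add: MC_simp_iff)
    then show ?thesis
      unfolding face[OF i(1,2), symmetric] curv_pull[OF x_space f(1)] f(2) .
  qed
  \<comment> \<open>All pieces of the top simplex other than \<open>?\<sigma>\<close>, and all its
    omissions at positions other than \<open>k\<close>, are faces covered by
    \<open>curv_other\<close>.\<close>
  have "curv Q (twist x) m ?\<sigma> \<in> F m" if m: "1 \<le> m" for m
  proof (rule curv_missing_face)
    show "twist x [] = 0" using tensor_space_Nil[OF x_space] by simp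
    show "twist x p \<in> gr (- int (length p - 1))" for p by (rule twist_gr[OF x_gr])
    show "k < length ?T" using k by simp
    show "curv Q (twist x) r (take (Suc i) (drop j ?T)) \<in> F r"
      if "take (Suc i) (drop j ?T) \<noteq> []" "take (Suc i) (drop j ?T) \<noteq> ?\<sigma>" "1 \<le> r" for i j r
      using that by (intro curv_other sublist_in_faces[OF T])
    show "curv Q (twist x) r (omit g ?T) \<in> F r" if "g < length ?T" "g \<noteq> k" "1 \<le> r" for g r
    proof (rule curv_other[OF _ _ that(3)])
      have "length (omit g ?T) = Suc n" using that(1) by (subst length_omit) auto
      then show "omit g ?T \<in> faces (Suc n)" using omit_in_faces[OF T, of g] by fastforce
      have "g \<notin> set (omit g ?T)" using that(1)
        by (auto simp: omit_def take_upt drop_upt simp del: upt_Suc)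
      then show "omit g ?T \<noteq> ?\<sigma>" using set\<sigma>[of g] that lenT by (metis less_Suc_eq_le)
    qed
  qed (rule m)
  then have "x \<in> MC_simp smul gr Q F (Suc n)"
    using curv_other x_gr unfolding MC_simp_iff by metis
  then show ?thesis using face by (intro bexI[of _ x]) (simp add: MC_face_eq[OF x_space])
qed

end

theorem corollary6p6:
  fixes smul :: "'k::field \<Rightarrow> 'a::ab_group_add \<Rightarrow> 'a"
    and gr :: "int \<Rightarrow> 'a set"
    and Q :: "'a list \<Rightarrow> 'a"
    and F :: "nat \<Rightarrow> 'a set"
  assumes "complete_shifted_Ainf smul gr Q F"
  shows "kan_complex (MC_simp smul gr Q F) (MC_face smul) (MC_degen smul)"
proof -
  interpret complete_shifted_Ainf smul gr Q F by (rule assms)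
  show ?thesis
    by (intro kan_complex.intro kan_complex_axioms.intro simplicial_set_MC horn_filler_MC)
qed

end
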